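(* Let $\mathcal{H}$ be a Kreĭn space, let $C\in\mathcal{L}(\mathcal{H})$ be a selfadjoint operator, and let $\mathcal{A}$ be a Kreĭn space. Then there exists an operator $A\in\mathcal{L}(\mathcal{A},\mathcal{H})$ such that $$C=AA^*\quad\text{and}\quad \ker A=\{0\}$$ if and only if $\operatorname{ind}_+\mathcal{A}=h_+(C)$ and $\operatorname{ind}_-\mathcal{A}=h_-(C)$.
   Context: A Kreĭn space is a complex inner product space $(\mathcal{H},\langle\cdot,\cdot\rangle_{\mathcal{H}})$ admitting a fundamental decomposition, that is, an orthogonal direct sum decomposition $\mathcal{H}=\mathcal{H}_+\oplus\mathcal{H}_-$ in which $\mathcal{H}_+$ is a Hilbert space and $\mathcal{H}_-$ is the antispace of a Hilbert space (i.e. it becomes a Hilbert space when its inner product is multiplied by $-1$). Separability is not assumed. The indices $\operatorname{ind}_\pm\mathcal{H}=\dim\mathcal{H}_\pm$ (cardinal numbers) do not depend on the choice of fundamental decomposition. Replacing the inner product of $\mathcal{H}_-$ by its negative gives an associated Hilbert space $|\mathcal{H}|$, equal to $\mathcal{H}$ as a vector space; all associated Hilbert space norms are equivalent and define the strong topology of $\mathcal{H}$. Topological notions (closed, continuous) refer to the strong topology. A subspace is a linear manifold, not necessarily closed; the dimension of a closed subspace is its Hilbert space dimension (cardinality of an orthonormal basis) in any associated Hilbert space. $\mathcal{L}(\mathcal{H},\mathcal{K})$ is the space of everywhere defined continuous linear operators from $\mathcal{H}$ to $\mathcal{K}$, and $\mathcal{L}(\mathcal{H})=\mathcal{L}(\mathcal{H},\mathcal{H})$.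 The adjoint $A^*\in\mathcal{L}(\mathcal{K},\mathcal{H})$ of $A\in\mathcal{L}(\mathcal{H},\mathcal{K})$ is the Kreĭn space adjoint: $\langle Af,g\rangle_{\mathcal{K}}=\langle f,A^*g\rangle_{\mathcal{H}}$; $C\in\mathcal{L}(\mathcal{H})$ is selfadjoint if $C=C^*$. For a selfadjoint $C\in\mathcal{L}(\mathcal{H})$, the $C$-inner product is $\langle f,g\rangle_C=\langle Cf,g\rangle_{\mathcal{H}}$. A subspace $\mathcal{M}$ is $C$-strictly positive (respectively $C$-strictly negative) if $\langle f,f\rangle_C>0$ (respectively $<0$) for every nonzero $f\in\mathcal{M}$. The hermitian index $h_+(C)$ (respectively $h_-(C)$) is the maximum dimension of a closed $C$-strictly positive (respectively $C$-strictly negative) subspace of $\mathcal{H}$; this maximum is attained. *)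

theory Defs
  imports "HOL-Analysis.Analysis"
begin

unbundle cardinal_syntax

text \<open>
  A complex inner product space is given by a scalar multiplication and a (possibly
  indefinite) inner product on a whole type \<open>'a\<close>, whose addition comes from the type class.
  Inner products are linear in the first argument. Cardinal numbers are the cardinal orders of
  the library, compared across types by \<open>=o\<close> and \<open>\<le>o\<close>.
\<close>

record 'a ips =
  cscale :: "complex \<Rightarrow> 'a \<Rightarrow> 'a"
  cinner :: "'a \<Rightarrow> 'a \<Rightarrow> complex"

locale inner_product_space = vector_space "cscale H" for H :: "'a::ab_group_add ips" +
  assumes cinner_add_left: "cinner H (x + y) z = cinner H x z + cinner H y z"
    and cinner_scale_left: "cinner H (cscale H a x) y = a * cinner H x y"
    and cinner_hermitian: "cinner H y x = cnj (cinner H x y)"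

definition antispace :: "'a ips \<Rightarrow> 'a ips" where
  "antispace H = H\<lparr>cinner := \<lambda>x y. - cinner H x y\<rparr>"

definition cdist :: "'a::ab_group_add ips \<Rightarrow> 'a \<Rightarrow> 'a \<Rightarrow> real" where
  "cdist H x y = sqrt (cmod (cinner H (x - y) (x - y)))"

text \<open>
  On a positive definite subspace the modulus in \<open>cdist\<close> is redundant; it is there because
  \<open>Metric_space S d\<close> demands \<open>d\<close> to be nonnegative also outside \<open>S\<close>.
  The values \<open>cinner H x x\<close> are real by hermitian symmetry, and \<open>Re\<close> below only coerces them.
\<close>

definition hilbert_subspace :: "'a::ab_group_add ips \<Rightarrow> 'a set \<Rightarrow> bool" where
  "hilbert_subspace H S \<longleftrightarrow>
     module.subspace (cscale H) S \<and>
     (\<forall>x\<in>S. x \<noteq> 0 \<longrightarrow> 0 < Re (cinner H x x)) \<and>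
     Metric_space.mcomplete S (cdist H)"

definition fundamental_decomposition ::
    "'a::ab_group_add ips \<Rightarrow> 'a set \<Rightarrow> 'a set \<Rightarrow> bool" where
  "fundamental_decomposition H P N \<longleftrightarrow>
     hilbert_subspace H P \<and> hilbert_subspace (antispace H) N \<and>
     (\<forall>p\<in>P. \<forall>n\<in>N. cinner H p n = 0) \<and>
     P \<inter> N = {0} \<and> (\<forall>x. \<exists>p\<in>P. \<exists>n\<in>N. x = p + n)"

definition krein_space :: "'a::ab_group_add ips \<Rightarrow> bool" where
  "krein_space H \<longleftrightarrow> inner_product_space H \<and> (\<exists>P N. fundamental_decomposition H P N)"

definition component :: "'a::ab_group_add set \<Rightarrow> 'a set \<Rightarrow> 'a \<Rightarrow> 'a" where
  "component P N x = (THE p. p \<in> P \<and> x - p \<in> N)"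

definition associated_hilbert ::
    "'a::ab_group_add ips \<Rightarrow> 'a set \<Rightarrow> 'a set \<Rightarrow> 'a ips" where
  "associated_hilbert H P N = H\<lparr>cinner := \<lambda>x y.
     cinner H (component P N x) (component P N y) -
     cinner H (component N P x) (component N P y)\<rparr>"

text \<open>
  The strong topology, Hilbert space dimensions and the indices do not depend on the fundamental
  decomposition, so they are defined from one that is chosen once and for all.
\<close>

definition pos_part :: "'a::ab_group_add ips \<Rightarrow> 'a set" where
  "pos_part H = fst (SOME (P, N). fundamental_decomposition H P N)"

definition neg_part :: "'a::ab_group_add ips \<Rightarrow> 'a set" where
  "neg_part H = snd (SOME (P, N). fundamental_decomposition H P N)"

definition abs_space :: "'a::ab_group_add ips \<Rightarrow> 'a ips" where
  "abs_space H = associated_hilbert H (pos_part H) (neg_part H)"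

definition strong_topology :: "'a::ab_group_add ips \<Rightarrow> 'a topology" where
  "strong_topology H = Metric_space.mtopology UNIV (cdist (abs_space H))"

definition closed_subspace :: "'a::ab_group_add ips \<Rightarrow> 'a set \<Rightarrow> bool" where
  "closed_subspace H M \<longleftrightarrow>
     module.subspace (cscale H) M \<and> closedin (strong_topology H) M"

definition orthonormal_basis :: "'a::ab_group_add ips \<Rightarrow> 'a set \<Rightarrow> 'a set \<Rightarrow> bool" where
  "orthonormal_basis H M B \<longleftrightarrow>
     (\<forall>b\<in>B. \<forall>c\<in>B. cinner (abs_space H) b c = (if b = c then 1 else 0)) \<and>
     strong_topology H closure_of (module.span (cscale H) B) = M"

definition hilbert_dim :: "'a::ab_group_add ips \<Rightarrow> 'a set \<Rightarrow> 'a rel" where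
  "hilbert_dim H M = card_of (SOME B. orthonormal_basis H M B)"

definition ind_pos :: "'a::ab_group_add ips \<Rightarrow> 'a rel" where
  "ind_pos H = hilbert_dim H (pos_part H)"

definition ind_neg :: "'a::ab_group_add ips \<Rightarrow> 'a rel" where
  "ind_neg H = hilbert_dim H (neg_part H)"

definition bounded_ops ::
    "'a::ab_group_add ips \<Rightarrow> 'b::ab_group_add ips \<Rightarrow> ('a \<Rightarrow> 'b) set" where
  "bounded_ops H K = {T. Vector_Spaces.linear (cscale H) (cscale K) T \<and>
     continuous_map (strong_topology H) (strong_topology K) T}"

definition krein_adjoint ::
    "'a::ab_group_add ips \<Rightarrow> 'b::ab_group_add ips \<Rightarrow> ('a \<Rightarrow> 'b) \<Rightarrow> 'b \<Rightarrow> 'a" where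
  "krein_adjoint H K T = (THE S. S \<in> bounded_ops K H \<and>
     (\<forall>f g. cinner K (T f) g = cinner H f (S g)))"

definition selfadjoint :: "'a::ab_group_add ips \<Rightarrow> ('a \<Rightarrow> 'a) \<Rightarrow> bool" where
  "selfadjoint H C \<longleftrightarrow> C = krein_adjoint H H C"

definition op_inner :: "'a ips \<Rightarrow> ('a \<Rightarrow> 'a) \<Rightarrow> 'a \<Rightarrow> 'a \<Rightarrow> complex" where
  "op_inner H C f g = cinner H (C f) g"

definition strictly_positive ::
    "'a::ab_group_add ips \<Rightarrow> ('a \<Rightarrow> 'a) \<Rightarrow> 'a set \<Rightarrow> bool" where
  "strictly_positive H C M \<longleftrightarrow> (\<forall>f\<in>M. f \<noteq> 0 \<longrightarrow> 0 < Re (op_inner H C f f))"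

definition strictly_negative ::
    "'a::ab_group_add ips \<Rightarrow> ('a \<Rightarrow> 'a) \<Rightarrow> 'a set \<Rightarrow> bool" where
  "strictly_negative H C M \<longleftrightarrow> (\<forall>f\<in>M. f \<noteq> 0 \<longrightarrow> Re (op_inner H C f f) < 0)"

text \<open>The maximum is attained for selfadjoint continuous \<open>C\<close>, so that the hermitian indices
  below, chosen as the dimension of some maximizing subspace, are well defined up to \<open>=o\<close>.\<close>

definition max_hilbert_dim ::
    "'a::ab_group_add ips \<Rightarrow> ('a set \<Rightarrow> bool) \<Rightarrow> 'a rel" where
  "max_hilbert_dim H Q = hilbert_dim H
     (SOME M. Q M \<and> (\<forall>M'. Q M' \<longrightarrow> hilbert_dim H M' \<le>o hilbert_dim H M))"

definition herm_index_pos :: "'a::ab_group_add ips \<Rightarrow> ('a \<Rightarrow> 'a) \<Rightarrow> 'a rel" where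
  "herm_index_pos H C = max_hilbert_dim H (\<lambda>M. closed_subspace H M \<and> strictly_positive H C M)"

definition herm_index_neg :: "'a::ab_group_add ips \<Rightarrow> ('a \<Rightarrow> 'a) \<Rightarrow> 'a rel" where
  "herm_index_neg H C = max_hilbert_dim H (\<lambda>M. closed_subspace H M \<and> strictly_negative H C M)"

end

theory Submission
  imports Defs
begin

text \<open>
  Let \<open>K\<close> and \<open>L\<close> be the Hilbert spaces associated with \<open>\<H>\<close> and \<open>\<A>\<close>, with fundamental symmetries
  \<open>J\<^sub>\<H>\<close> and \<open>J\<^sub>\<A>\<close>. The operator \<open>G = J\<^sub>\<H> C\<close> is selfadjoint in \<open>K\<close>, and the \<open>C\<close>-inner product is the
  form \<open>\<langle>G f, g\<rangle>\<close> of \<open>K\<close>. The space \<open>K\<close> is the orthogonal sum of the kernel of \<open>G\<close> and of closed subspaces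
  \<open>P\<close> and \<open>N\<close> on which \<open>G\<close> is strictly positive and strictly negative, and \<open>\<bar>G\<bar>\<close> has a square root \<open>R\<close> that
  reduces this decomposition (\<open>spectral_split_exists\<close>). A vector with no component in \<open>P\<close> has nonpositive
  \<open>G\<close>-form, so every strictly positive subspace is projected injectively to \<open>P\<close>. Since a bounded
  injective operator cannot lower the Hilbert space dimension (\<open>onb_card_le\<close>), \<open>h\<^sub>+(C) = dim P\<close> and
  likewise \<open>h\<^sub>-(C) = dim N\<close>.

  If \<open>C = A A\<^sup>*\<close> with \<open>ker A = {0}\<close>, then \<open>T = A\<^sup>*\<close> has dense range and \<open>\<langle>G f, g\<rangle> = \<langle>J\<^sub>\<A> T f, T g\<rangle>\<close>. From
  this one obtains injective bounded operators from \<open>P\<close> to \<open>\<A>\<^sub>+\<close> and back (\<open>factor_index\<close>).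
  Comparing dimensions through such injections covers finite and infinite dimension alike.

  Conversely, if the dimensions agree, a bijection of orthonormal bases extends to an isometry \<open>W\<close> of \<open>L\<close>
  onto the closed sum of \<open>P\<close> and \<open>N\<close> that matches \<open>\<A>\<^sub>\<plusminus>\<close> with \<open>P\<close> and \<open>N\<close>. With the Hilbert space adjoint
  \<open>W\<^sup>*\<close>, the operator \<open>W J\<^sub>\<A> W\<^sup>*\<close> is the sign of \<open>G\<close>, whence \<open>(R W) J\<^sub>\<A> (R W)\<^sup>* = G\<close>, and
  \<open>A = J\<^sub>\<H> R W\<close> is the required factor (\<open>factor_exists\<close>).
\<close>


section \<open>Positive definite inner products\<close>

context inner_product_space
begin

lemma cinner_add_right: "cinner H x (y + z) = cinner H x y + cinner H x z"
  by (metis cinner_add_left cinner_hermitian complex_cnj_add)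

lemma cinner_scale_right: "cinner H x (cscale H a y) = cnj a * cinner H x y"
  by (metis cinner_scale_left cinner_hermitian complex_cnj_mult)

lemma cinner_zero_left [simp]: "cinner H 0 x = 0"
  using cinner_add_left[of 0 0 x] by simp

lemma cinner_zero_right [simp]: "cinner H x 0 = 0"
  using cinner_add_right[of x 0 0] by simp

lemma cinner_diff_left: "cinner H (x - y) z = cinner H x z - cinner H y z"
  using cinner_add_left[of "x - y" y z] by simp

lemma cinner_diff_right: "cinner H x (y - z) = cinner H x y - cinner H x z"
  using cinner_add_right[of x "y - z" z] by simp

lemma cinner_minus_left: "cinner H (- x) y = - cinner H x y"
  using cinner_diff_left[of 0 x y] by simp

lemma cinner_minus_right: "cinner H x (- y) = - cinner H x y"
  using cinner_diff_right[of x 0 y] by simp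

lemmas cinner_simps = cinner_add_left cinner_add_right cinner_diff_left cinner_diff_right
  cinner_scale_left cinner_scale_right cinner_minus_left cinner_minus_right

lemma cinner_self_real: "cinner H x x = complex_of_real (Re (cinner H x x))"
  by (metis Reals_cnj_iff cinner_hermitian complex_is_Real_iff of_real_Re)

lemma cinner_eq_0_commute: "cinner H x y = 0 \<longleftrightarrow> cinner H y x = 0"
  by (metis cinner_hermitian complex_cnj_zero_iff)

lemma Re_cinner_commute: "Re (cinner H x y) = Re (cinner H y x)"
  using cinner_hermitian[of x y] by simp

end

text \<open>Norms, operators and closures belong to an inner product that is a parameter of the statements
  and not to the type of the vectors: one type carries a Krein space together with its associated
  Hilbert space.\<close>

definition vnorm :: "'a::ab_group_add ips \<Rightarrow> 'a \<Rightarrow> real" where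
  "vnorm K x = sqrt (Re (cinner K x x))"

locale pos_def_space = inner_product_space K for K :: "'a::ab_group_add ips" +
  assumes cinner_pos: "x \<noteq> 0 \<Longrightarrow> 0 < Re (cinner K x x)"
begin

abbreviation "ip \<equiv> cinner K"
abbreviation "sc \<equiv> cscale K"
abbreviation "nr \<equiv> vnorm K"

lemma cinner_ge_0: "0 \<le> Re (ip x x)"
  using cinner_pos[of x] by (cases "x = 0") auto

lemma vnorm_ge_0 [simp]: "0 \<le> nr x"
  by (simp add: vnorm_def cinner_ge_0)

lemma vnorm_square: "(nr x)\<^sup>2 = Re (ip x x)"
  by (simp add: vnorm_def cinner_ge_0)

lemma cinner_self: "ip x x = complex_of_real ((nr x)\<^sup>2)"
  using cinner_self_real vnorm_square by metis

lemma vnorm_eq_0 [simp]: "nr x = 0 \<longleftrightarrow> x = 0"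
  using cinner_pos[of x] by (cases "x = 0") (auto simp: vnorm_def)

lemma cinner_self_eq_0D: "ip x x = 0 \<Longrightarrow> x = 0"
  using cinner_pos[of x] by auto

lemma vnorm_zero [simp]: "nr 0 = 0"
  by simp

lemma vnorm_pos: "x \<noteq> 0 \<Longrightarrow> 0 < nr x"
  using vnorm_eq_0 vnorm_ge_0 by (metis less_eq_real_def)

lemma vnorm_scale: "nr (sc a x) = cmod a * nr x"
proof -
  have "Re (ip (sc a x) (sc a x)) = (cmod a)\<^sup>2 * Re (ip x x)"
    by (simp add: cinner_simps cinner_self[of x] cmod_power2) (simp add: power2_eq_square algebra_simps)
  then show ?thesis
    by (simp add: vnorm_def real_sqrt_mult)
qed

lemma vnorm_minus [simp]: "nr (- x) = nr x"
  by (simp add: vnorm_def cinner_simps)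

lemma vnorm_diff_commute: "nr (x - y) = nr (y - x)"
  by (metis minus_diff_eq vnorm_minus)

lemma Cauchy_Schwarz: "cmod (ip x y) \<le> nr x * nr y"
proof (cases "y = 0")
  case False
  define r where "r = Re (ip y y)"
  have r: "r > 0" using False cinner_pos r_def by blast
  have yy: "ip y y = complex_of_real r" using cinner_self_real r_def by simp
  define z where "z = sc (complex_of_real r) x - sc (ip x y) y"
  have zy: "ip z y = 0" by (simp add: z_def cinner_simps yy)
  have "ip z z = complex_of_real r * ip z x"
  proof -
    have "ip z z = ip z (sc (complex_of_real r) x - sc (ip x y) y)" by (simp add: z_def)
    then show ?thesis by (simp add: cinner_diff_right cinner_scale_right zy)
  qed
  also have "\<dots> = complex_of_real r * (complex_of_real r * ip x x - ip x y * cnj (ip x y))"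
    by (simp add: z_def cinner_simps cinner_hermitian[of x y])
  also have "\<dots> = complex_of_real (r * (r * (nr x)\<^sup>2 - (cmod (ip x y))\<^sup>2))"
    by (simp add: cinner_self[of x] complex_norm_square[symmetric])
  finally have "0 \<le> r * (r * (nr x)\<^sup>2 - (cmod (ip x y))\<^sup>2)"
    using cinner_ge_0[of z] by simp
  then have "(cmod (ip x y))\<^sup>2 \<le> (nr x * nr y)\<^sup>2"
    using r by (simp add: zero_le_mult_iff power_mult_distrib vnorm_square[of y] r_def mult.commute)
  then show ?thesis
    by (rule power2_le_imp_le) simp
qed simp

lemma vnorm_le_if_functional_le:
  assumes "c \<ge> 0" "\<And>y. cmod (ip z y) \<le> c * nr y"
  shows "nr z \<le> c"
proof (cases "z = 0")
  case False
  have "nr z * nr z = cmod (ip z z)"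
    unfolding cinner_self norm_of_real by (simp add: power2_eq_square)
  also have "\<dots> \<le> c * nr z" by (rule assms)
  finally show ?thesis using vnorm_pos[OF False] by simp
qed (use assms in simp)

lemma vnorm_add_square: "(nr (x + y))\<^sup>2 = (nr x)\<^sup>2 + 2 * Re (ip x y) + (nr y)\<^sup>2"
  using Re_cinner_commute[of x y] by (simp add: vnorm_square cinner_simps)

lemma vnorm_diff_square: "(nr (x - y))\<^sup>2 = (nr x)\<^sup>2 - 2 * Re (ip x y) + (nr y)\<^sup>2"
  using Re_cinner_commute[of x y] by (simp add: vnorm_square cinner_simps)

lemma parallelogram: "(nr (x + y))\<^sup>2 + (nr (x - y))\<^sup>2 = 2 * (nr x)\<^sup>2 + 2 * (nr y)\<^sup>2"
  by (simp add: vnorm_add_square vnorm_diff_square)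

lemma Pythagoras: "ip x y = 0 \<Longrightarrow> (nr (x + y))\<^sup>2 = (nr x)\<^sup>2 + (nr y)\<^sup>2"
  by (simp add: vnorm_add_square)

lemma vnorm_triangle: "nr (x + y) \<le> nr x + nr y"
proof -
  have "Re (ip x y) \<le> nr x * nr y"
    using Cauchy_Schwarz complex_Re_le_cmod order_trans by blast
  then have "(nr (x + y))\<^sup>2 \<le> (nr x + nr y)\<^sup>2"
    by (simp add: vnorm_add_square power2_sum)
  then show ?thesis by (rule power2_le_imp_le) simp
qed

lemma vnorm_triangle_diff: "nr (x - z) \<le> nr (x - y) + nr (y - z)"
  using vnorm_triangle[of "x - y" "y - z"] by simp

lemma cdist_vnorm: "cdist K x y = nr (x - y)"
  using cinner_self[of "x - y"] by (simp add: cdist_def norm_power)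

lemma Metric_space_cdist: "Metric_space S (cdist K)"
  by unfold_locales (simp_all add: cdist_vnorm vnorm_diff_commute vnorm_triangle_diff)

lemma eq_0_if_orthogonal_all: "(\<And>y. ip x y = 0) \<Longrightarrow> x = 0"
  by (rule cinner_self_eq_0D) blast

lemma eq_if_cinner_eq: "(\<And>z. ip x z = ip y z) \<Longrightarrow> x = y"
  using eq_0_if_orthogonal_all[of "x - y"] by (simp add: cinner_simps)

lemma sum_cinner_left: "ip (\<Sum>i\<in>I. f i) y = (\<Sum>i\<in>I. ip (f i) y)"
  by (induction I rule: infinite_finite_induct) (auto simp: cinner_simps)

end

section \<open>Bounded operators and closed subspaces\<close>

text \<open>For associated Hilbert spaces of Krein spaces, the three notions below express continuity, closure
  and closedness with respect to the strong topology.\<close>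

definition bop :: "'a::ab_group_add ips \<Rightarrow> 'b::ab_group_add ips \<Rightarrow> ('a \<Rightarrow> 'b) \<Rightarrow> bool" where
  "bop K L T \<longleftrightarrow> (\<forall>x y. T (x + y) = T x + T y) \<and> (\<forall>a x. T (cscale K a x) = cscale L a (T x)) \<and>
     (\<exists>c\<ge>0. \<forall>x. vnorm L (T x) \<le> c * vnorm K x)"

lemma bop_add: "bop K L T \<Longrightarrow> T (x + y) = T x + T y"
  by (simp add: bop_def)

lemma bop_scale: "bop K L T \<Longrightarrow> T (cscale K a x) = cscale L a (T x)"
  by (simp add: bop_def)

lemma bop_zero: "bop K L T \<Longrightarrow> T 0 = 0"
  by (metis add_cancel_right_left bop_add)

lemma bop_diff: "bop K L T \<Longrightarrow> T (x - y) = T x - T y"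
  by (metis bop_add diff_add_cancel eq_diff_eq)

lemma bop_minus: "bop K L T \<Longrightarrow> T (- x) = - T x"
  using bop_diff[of K L T 0 x] by (simp add: bop_zero)

lemma bop_comp:
  assumes "bop K L S" "bop L M T"
  shows "bop K M (\<lambda>x. T (S x))"
proof -
  obtain c d where c: "c \<ge> 0" "\<And>x. vnorm L (S x) \<le> c * vnorm K x"
    and d: "d \<ge> 0" "\<And>x. vnorm M (T x) \<le> d * vnorm L x"
    using assms unfolding bop_def by blast
  have "vnorm M (T (S x)) \<le> (d * c) * vnorm K x" for x
    using d(2)[of "S x"] mult_left_mono[OF c(2)[of x] d(1)] by (simp add: mult.assoc)
  then show ?thesis
    using assms c(1) d(1) unfolding bop_def by (metis mult_nonneg_nonneg)
qed

definition cl :: "'a::ab_group_add ips \<Rightarrow> 'a set \<Rightarrow> 'a set" where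
  "cl K S = {x. \<forall>e>0. \<exists>y\<in>S. vnorm K (x - y) < e}"

lemma clD: "x \<in> cl K S \<Longrightarrow> e > 0 \<Longrightarrow> \<exists>y\<in>S. vnorm K (x - y) < e"
  by (simp add: cl_def)

lemma clI: "(\<And>e. e > 0 \<Longrightarrow> \<exists>y\<in>S. vnorm K (x - y) < e) \<Longrightarrow> x \<in> cl K S"
  by (simp add: cl_def)

definition clsub :: "'a::ab_group_add ips \<Rightarrow> 'a set \<Rightarrow> bool" where
  "clsub K M \<longleftrightarrow> module.subspace (cscale K) M \<and> cl K M \<subseteq> M"

context pos_def_space
begin

lemma bop_bound:
  assumes "bop K L T"
  obtains c where "c > 0" "\<And>x. vnorm L (T x) \<le> c * nr x"
proof -
  obtain c where c: "c \<ge> 0" "\<And>x. vnorm L (T x) \<le> c * nr x"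
    using assms unfolding bop_def by blast
  have "vnorm L (T x) \<le> (c + 1) * nr x" for x
    using c(2)[of x] vnorm_ge_0[of x] unfolding distrib_right by linarith
  then show ?thesis using that[of "c + 1"] c(1) by simp
qed

lemma bop_id: "bop K K (\<lambda>x. x)"
  unfolding bop_def using exI[of "\<lambda>c. c \<ge> 0 \<and> (\<forall>x. nr x \<le> c * nr x)" 1] by simp

lemma bop_add_fun:
  assumes "bop L K S" "bop L K T"
  shows "bop L K (\<lambda>x. S x + T x)"
proof -
  obtain c d where c: "c \<ge> 0" "\<And>x. nr (S x) \<le> c * vnorm L x"
    and d: "d \<ge> 0" "\<And>x. nr (T x) \<le> d * vnorm L x"
    using assms unfolding bop_def by blast
  have "nr (S x + T x) \<le> (c + d) * vnorm L x" for x
    using vnorm_triangle[of "S x" "T x"] c(2)[of x] d(2)[of x] by (simp add: distrib_right)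
  then show ?thesis
    using assms c(1) d(1) unfolding bop_def
    by (auto simp: scale_right_distrib algebra_simps intro!: exI[of _ "c + d"])
qed

lemma bop_uminus_fun: "bop L K T \<Longrightarrow> bop L K (\<lambda>x. - T x)"
  unfolding bop_def by (simp add: scale_minus_right)

lemma bop_diff_fun:
  assumes "bop L K S" "bop L K T"
  shows "bop L K (\<lambda>x. S x - T x)"
  using bop_add_fun[OF assms(1) bop_uminus_fun[OF assms(2)]] by simp

lemma bop_scale_fun:
  assumes "bop L K T"
  shows "bop L K (\<lambda>x. sc a (T x))"
proof -
  obtain c where c: "c \<ge> 0" "\<And>x. nr (T x) \<le> c * vnorm L x"
    using assms unfolding bop_def by blast
  have "nr (sc a (T x)) \<le> (cmod a * c) * vnorm L x" for x
    using mult_left_mono[OF c(2)[of x], of "cmod a"] by (simp add: vnorm_scale mult.assoc)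
  moreover have "0 \<le> cmod a * c" using c by simp
  ultimately show ?thesis
    using assms unfolding bop_def by (auto simp: scale_right_distrib mult.commute)
qed

lemma subset_cl: "S \<subseteq> cl K S"
  unfolding cl_def by auto (metis diff_self vnorm_zero)

lemma cl_mono: "S \<subseteq> T \<Longrightarrow> cl K S \<subseteq> cl K T"
  unfolding cl_def by blast

lemma cl_idem: "cl K (cl K S) \<subseteq> cl K S"
proof
  fix x assume x: "x \<in> cl K (cl K S)"
  have "\<exists>z\<in>S. nr (x - z) < e" if "e > 0" for e
  proof -
    obtain y where "y \<in> cl K S" and y: "nr (x - y) < e/2" 
      using clD[OF x, of "e/2"] \<open>e > 0\<close> by auto
    then obtain z where "z \<in> S" "nr (y - z) < e/2"
      using clD[of y K S "e/2"] \<open>e > 0\<close> by auto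
    with y vnorm_triangle_diff[of x z y] show ?thesis by force
  qed
  then show "x \<in> cl K S" by (simp add: cl_def)
qed

lemma subspace_cl:
  assumes "subspace S"
  shows "subspace (cl K S)"
proof (rule subspaceI)
  show "0 \<in> cl K S" using subset_cl subspace_0[OF assms] by blast
next
  fix x y assume x: "x \<in> cl K S" and y: "y \<in> cl K S"
  have "\<exists>z\<in>S. nr (x + y - z) < e" if "e > 0" for e
  proof -
    obtain u where u: "u \<in> S" "nr (x - u) < e/2" 
      using clD[OF x, of "e/2"] \<open>e > 0\<close> by auto
    obtain v where v: "v \<in> S" "nr (y - v) < e/2" 
      using clD[OF y, of "e/2"] \<open>e > 0\<close> by auto
    have "nr (x + y - (u + v)) < e"
      using vnorm_triangle[of "x - u" "y - v"] u v by (simp add: add_diff_add)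
    then show ?thesis using u v assms subspace_add by blast
  qed
  then show "x + y \<in> cl K S" by (simp add: cl_def)
next
  fix a x assume x: "x \<in> cl K S"
  have "\<exists>z\<in>S. nr (sc a x - z) < e" if "e > 0" for e
  proof -
    have "e / (cmod a + 1) > 0" using that by (simp add: add_nonneg_pos)
    then obtain u where u: "u \<in> S" "nr (x - u) < e / (cmod a + 1)" 
      using x unfolding cl_def by blast
    have "nr (sc a x - sc a u) = cmod a * nr (x - u)"
      by (metis scale_right_diff_distrib vnorm_scale)
    also have "\<dots> \<le> (cmod a + 1) * nr (x - u)" by (simp add: distrib_right)
    also have "\<dots> < e" using u(2) by (simp add: pos_less_divide_eq add_nonneg_pos mult.commute)
    finally show ?thesis using u assms subspace_scale by blast
  qed
  then show "sc a x \<in> cl K S" by (simp add: cl_def)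
qed

lemma clsub_cl: "subspace S \<Longrightarrow> clsub K (cl K S)"
  unfolding clsub_def using subspace_cl cl_idem by blast

lemma cl_span_subset: "clsub K D \<Longrightarrow> S \<subseteq> D \<Longrightarrow> cl K (span S) \<subseteq> D"
  unfolding clsub_def using cl_mono span_minimal by blast

lemma clsub_subspace: "clsub K D \<Longrightarrow> subspace D"
  by (simp add: clsub_def)

lemma clsub_Int: "clsub K D \<Longrightarrow> clsub K E \<Longrightarrow> clsub K (D \<inter> E)"
  unfolding clsub_def by (metis cl_mono inf_le1 inf_le2 le_inf_iff order_trans subspace_inter)

lemma clsub_UNIV: "clsub K UNIV"
  by (simp add: clsub_def)

lemma clsub_vimage:
  assumes L: "pos_def_space L" and T: "bop K L T" and D: "clsub L D"
  shows "clsub K {x. T x \<in> D}"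
proof -
  interpret L: pos_def_space L by fact
  have sub: "subspace {x. T x \<in> D}"
    using L.clsub_subspace[OF D] T
    by (intro subspaceI) (auto simp: bop_add bop_scale bop_zero L.subspace_0 L.subspace_add L.subspace_scale)
  obtain c where c: "c > 0" "\<And>x. vnorm L (T x) \<le> c * nr x"
    using bop_bound[OF T] by metis
  have "T x \<in> cl L D" if x: "x \<in> cl K {x. T x \<in> D}" for x
  proof -
    have "\<exists>y\<in>D. vnorm L (T x - y) < e" if "e > 0" for e
    proof -
      have "e / c > 0" using that c by simp
      then obtain u where u: "T u \<in> D" "nr (x - u) < e / c" 
        using x unfolding cl_def by blast
      have "vnorm L (T x - T u) \<le> c * nr (x - u)"
        using c(2)[of "x - u"] T by (simp add: bop_diff)
      also have "\<dots> < e" using u(2) c(1) by (simp add: pos_less_divide_eq mult.commute)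
      finally show ?thesis using u(1) by blast
    qed
    then show ?thesis by (simp add: cl_def)
  qed
  then show ?thesis using sub D unfolding clsub_def by blast
qed

lemma clsub_zero: "clsub K {0}"
proof -
  have "x = 0" if "x \<in> cl K {0}" for x
  proof (rule ccontr)
    assume "x \<noteq> 0"
    then have "nr x > 0" by (rule vnorm_pos)
    then show False using that unfolding cl_def by auto
  qed
  then show ?thesis unfolding clsub_def by auto
qed

lemma clsub_kernel:
  assumes "pos_def_space L" "bop K L T"
  shows "clsub K {x. T x = 0}"
  using clsub_vimage[OF assms pos_def_space.clsub_zero[OF assms(1)]] by simp

lemma clsub_equalizer:
  assumes "pos_def_space L" "bop K L S" "bop K L T"
  shows "clsub K {x. S x = T x}"
  using clsub_kernel[OF assms(1) pos_def_space.bop_diff_fun[OF assms]] by simp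

lemma clsub_orth: "clsub K {x. \<forall>z\<in>Z. ip x z = 0}"
proof -
  have sub: "subspace {x. \<forall>z\<in>Z. ip x z = 0}"
    by (intro subspaceI) (auto simp: cinner_simps)
  have "ip x z = 0" if x: "x \<in> cl K {x. \<forall>z\<in>Z. ip x z = 0}" and z: "z \<in> Z" for x z
  proof (rule ccontr)
    assume nz: "ip x z \<noteq> 0"
    define e where "e = cmod (ip x z) / (nr z + 1)"
    have p: "nr z + 1 > 0" by (simp add: add_nonneg_pos)
    have "e > 0" using nz p by (simp add: e_def)
    then obtain u where u: "ip u z = 0" "nr (x - u) < e"
      using x z unfolding cl_def by blast
    have "cmod (ip x z) = cmod (ip (x - u) z)" by (simp add: cinner_simps u)
    also have "\<dots> \<le> nr (x - u) * nr z" by (rule Cauchy_Schwarz)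
    also have "\<dots> \<le> nr (x - u) * (nr z + 1)" by (simp add: mult_left_mono)
    also have "\<dots> < cmod (ip x z)" using u(2) p by (simp add: e_def pos_less_divide_eq)
    finally show False by simp
  qed
  then show ?thesis using sub unfolding clsub_def by auto
qed

end

section \<open>Orthogonal projection and the representation of forms\<close>

locale hilbert = pos_def_space +
  assumes complete: "Metric_space.mcomplete UNIV (cdist K)"
begin

lemma Cauchy_converges:
  fixes \<sigma> :: "nat \<Rightarrow> 'a"
  assumes "\<And>e. e > 0 \<Longrightarrow> \<exists>N. \<forall>m\<ge>N. \<forall>n\<ge>N. nr (\<sigma> m - \<sigma> n) < e"
  shows "\<exists>x. \<forall>e>0. \<exists>N. \<forall>n\<ge>N. nr (\<sigma> n - x) < e"
proof -
  interpret M: Metric_space UNIV "cdist K" by (rule Metric_space_cdist)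
  have "M.MCauchy \<sigma>"
    unfolding M.MCauchy_def using assms by (auto simp: cdist_vnorm)
  then obtain x where "limitin M.mtopology \<sigma> x sequentially"
    using complete M.mcomplete_def by blast
  then show ?thesis
    unfolding M.limit_metric_sequentially by (auto simp: cdist_vnorm)
qed

text \<open>A minimizing sequence for the distance from \<open>x\<close> to \<open>M\<close> is a Cauchy sequence by the
  parallelogram law, and its limit is the foot of the perpendicular.\<close>

lemma nearest_point:
  assumes M: "clsub K M"
  shows "\<exists>p\<in>M. \<forall>m\<in>M. nr (x - p) \<le> nr (x - m)"
proof -
  have sub: "subspace M" using M by (rule clsub_subspace)
  define d where "d = (INF m\<in>M. nr (x - m))"
  have bdd: "bdd_below ((\<lambda>m. nr (x - m)) ` M)"
    by (rule bdd_belowI[of _ 0]) auto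
  have ne: "M \<noteq> {}" using subspace_0[OF sub] by blast
  have d_le: "d \<le> nr (x - m)" if "m \<in> M" for m
    unfolding d_def using bdd that by (rule cINF_lower)
  have d0: "d \<ge> 0"
    unfolding d_def using ne by (intro cINF_greatest) auto
  have "\<exists>m\<in>M. nr (x - m) < d + e" if "e > 0" for e
    using cInf_lessD[of "(\<lambda>m. nr (x - m)) ` M" "d + e"] that ne unfolding d_def by auto
  then have "\<exists>m. m \<in> M \<and> nr (x - m) < d + inverse (real (Suc n))" for n
    by (metis inverse_positive_iff_positive of_nat_0_less_iff zero_less_Suc)
  then obtain m where m: "\<And>n. m n \<in> M" "\<And>n. nr (x - m n) < d + inverse (real (Suc n))"
    by metis
  have close: "(nr (m i - m j))\<^sup>2 \<le> \<eta> * (8 * d + 4 * \<eta>)"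
    if "nr (x - m i) \<le> d + \<eta>" "nr (x - m j) \<le> d + \<eta>" for i j \<eta>
  proof -
    define h where "h = sc (1/2) (m i + m j)"
    have "h \<in> M" unfolding h_def using m sub by (simp add: subspace_add subspace_scale)
    have "sc 2 (x - h) = (x - m i) + (x - m j)"
      unfolding h_def using scale_left_distrib[of 1 1 x]
      by (simp add: scale_right_diff_distrib)
    then have "nr ((x - m i) + (x - m j)) = 2 * nr (x - h)"
      using vnorm_scale[of 2 "x - h"] by simp
    then have "(nr ((x - m i) + (x - m j)))\<^sup>2 \<ge> 4 * d\<^sup>2"
      using d_le[OF \<open>h \<in> M\<close>] d0 by (simp add: power_mult_distrib power_mono)
    moreover have "nr ((x - m i) - (x - m j)) = nr (m i - m j)"
      using vnorm_diff_commute[of "m i" "m j"] by simp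
    moreover have "(nr (x - m i))\<^sup>2 \<le> (d + \<eta>)\<^sup>2" "(nr (x - m j))\<^sup>2 \<le> (d + \<eta>)\<^sup>2"
      using that by (simp_all add: power_mono)
    ultimately have "(nr (m i - m j))\<^sup>2 \<le> 4 * (d + \<eta>)\<^sup>2 - 4 * d\<^sup>2"
      using parallelogram[of "x - m i" "x - m j"] by simp
    then show ?thesis by (simp add: power2_eq_square algebra_simps)
  qed
  have "\<exists>N. \<forall>i\<ge>N. \<forall>j\<ge>N. nr (m i - m j) < e" if "e > 0" for e
  proof -
    \<comment> \<open>Chosen so that the bound \<open>\<eta> * (8 * d + 4 * \<eta>)\<close> of the parallelogram law drops below \<open>e\<^sup>2\<close>.\<close>
    define \<eta> where "\<eta> = min 1 (e\<^sup>2 / (8 * d + 5))"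
    have "\<eta> > 0" "\<eta> \<le> 1" "\<eta> \<le> e\<^sup>2 / (8 * d + 5)" using d0 \<open>e > 0\<close> by (auto simp: \<eta>_def)
    then have "\<eta> * (8 * d + 5) \<le> e\<^sup>2" using d0 by (simp add: pos_le_divide_eq)
    moreover have "\<eta> * (8 * d + 4 * \<eta>) < \<eta> * (8 * d + 5)"
      using \<open>\<eta> > 0\<close> \<open>\<eta> \<le> 1\<close> by (intro mult_strict_left_mono) auto
    ultimately have \<eta>: "\<eta> * (8 * d + 4 * \<eta>) < e\<^sup>2" by simp
    obtain N where N: "inverse (real (Suc N)) < \<eta>"
      using reals_Archimedean[OF \<open>\<eta> > 0\<close>] by blast
    have "nr (x - m i) \<le> d + \<eta>" if "i \<ge> N" for i
    proof -
      have "inverse (real (Suc i)) \<le> inverse (real (Suc N))" using that by simp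
      then show ?thesis using m(2)[of i] N by linarith
    qed
    then have "(nr (m i - m j))\<^sup>2 < e\<^sup>2" if "i \<ge> N" "j \<ge> N" for i j
      using close[of i \<eta> j] that \<eta> by fastforce
    then show ?thesis using \<open>e > 0\<close> by (meson less_eq_real_def power_less_imp_less_base)
  qed
  from Cauchy_converges[OF this]
  obtain p where p: "\<And>e. e > 0 \<Longrightarrow> \<exists>N. \<forall>n\<ge>N. nr (m n - p) < e" by blast
  have "p \<in> cl K M"
    using p m(1) by (intro clI) (metis order_refl vnorm_diff_commute)
  then have "p \<in> M" using M clsub_def by blast
  moreover have "nr (x - p) \<le> d"
  proof (rule field_le_epsilon)
    fix e :: real assume "e > 0"
    then obtain N where N: "\<forall>n\<ge>N. nr (m n - p) < e/2" using p[of "e/2"] by auto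
    obtain N' where N': "inverse (real (Suc N')) < e/2"
      using reals_Archimedean[of "e/2"] \<open>e > 0\<close> by auto
    have "inverse (real (Suc (max N N'))) \<le> inverse (real (Suc N'))" by simp
    then have "nr (x - m (max N N')) < d + e/2" using m(2)[of "max N N'"] N' by linarith
    moreover have "nr (m (max N N') - p) < e/2" using N by simp
    ultimately show "nr (x - p) \<le> d + e"
      using vnorm_triangle_diff[of x p "m (max N N')"] by linarith
  qed
  ultimately show ?thesis using d_le order_trans by blast
qed

text \<open>Moving from the nearest point \<open>p\<close> in the direction of \<open>m \<in> M\<close> by the component of \<open>x - p\<close> along
  \<open>m\<close> would decrease the distance to \<open>x\<close>, unless that component vanishes.\<close>

lemma orthogonal_foot:
  assumes M: "clsub K M"
  shows "\<exists>p\<in>M. \<forall>m\<in>M. ip (x - p) m = 0"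
proof -
  obtain p where p: "p \<in> M" "\<And>m. m \<in> M \<Longrightarrow> nr (x - p) \<le> nr (x - m)"
    using nearest_point[OF M] by blast
  have "ip (x - p) m = 0" if m: "m \<in> M" for m
  proof (cases "m = 0")
    case False
    define t where "t = ip (x - p) m"
    define r where "r = (nr m)\<^sup>2"
    have r: "r > 0" using False vnorm_pos by (simp add: r_def)
    define y where "y = sc (t / complex_of_real r) m"
    have "p + y \<in> M"
      using p(1) m M clsub_subspace subspace_add subspace_scale unfolding y_def by blast
    then have "(nr (x - p))\<^sup>2 \<le> (nr (x - p - y))\<^sup>2"
      using p(2) by (simp add: power_mono diff_diff_add)
    also have "\<dots> = (nr (x - p))\<^sup>2 - 2 * Re (ip (x - p) y) + (nr y)\<^sup>2"
      by (rule vnorm_diff_square)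
    also have "ip (x - p) y = complex_of_real ((cmod t)\<^sup>2 / r)"
      by (simp add: y_def cinner_scale_right t_def[symmetric] complex_norm_square[symmetric]
          mult.commute)
    also have "(nr y)\<^sup>2 = (cmod t)\<^sup>2 / r"
      using r by (simp add: y_def vnorm_scale norm_divide power_mult_distrib power_divide
          r_def[symmetric] power2_eq_square[of r])
    finally have "(cmod t)\<^sup>2 / r \<le> 0" by simp
    then show ?thesis using r by (simp add: divide_le_0_iff t_def)
  qed simp
  with p(1) show ?thesis by blast
qed

end

definition proj :: "'a::ab_group_add ips \<Rightarrow> 'a set \<Rightarrow> 'a \<Rightarrow> 'a" where
  "proj K M x = (SOME p. p \<in> M \<and> (\<forall>m\<in>M. cinner K (x - p) m = 0))"

context hilbert
begin

lemma proj_mem: "clsub K M \<Longrightarrow> proj K M x \<in> M"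
  and proj_orth: "clsub K M \<Longrightarrow> m \<in> M \<Longrightarrow> ip (x - proj K M x) m = 0"
proof -
  assume M: "clsub K M"
  have *: "proj K M x \<in> M \<and> (\<forall>m\<in>M. ip (x - proj K M x) m = 0)"
    unfolding proj_def by (rule someI_ex) (use orthogonal_foot[OF M] in blast)
  show "proj K M x \<in> M" using * by simp
  show "m \<in> M \<Longrightarrow> ip (x - proj K M x) m = 0" using * by simp
qed

lemma proj_unique:
  assumes M: "clsub K M" and p: "p \<in> M" "\<And>m. m \<in> M \<Longrightarrow> ip (x - p) m = 0"
  shows "proj K M x = p"
proof -
  let ?z = "proj K M x - p"
  have z: "?z \<in> M" using proj_mem[OF M] p M clsub_subspace subspace_diff by blast
  have "?z = (x - p) - (x - proj K M x)" by simp
  then have "ip ?z ?z = ip (x - p) ?z - ip (x - proj K M x) ?z"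
    by (metis cinner_diff_left)
  then have "ip ?z ?z = 0" using p(2)[OF z] proj_orth[OF M z] by simp
  then show ?thesis by (metis cinner_self_eq_0D right_minus_eq)
qed

lemma proj_eq_0D: "clsub K M \<Longrightarrow> proj K M x = 0 \<Longrightarrow> m \<in> M \<Longrightarrow> ip x m = 0"
  using proj_orth[of M m x] by simp

lemma bop_proj:
  assumes M: "clsub K M"
  shows "bop K K (proj K M)"
proof -
  note sub = clsub_subspace[OF M]
  have add: "proj K M (x + y) = proj K M x + proj K M y" for x y
  proof (rule proj_unique[OF M])
    show "proj K M x + proj K M y \<in> M"
      using proj_mem[OF M] sub subspace_add by blast
    fix m assume m: "m \<in> M"
    show "ip (x + y - (proj K M x + proj K M y)) m = 0"
      using proj_orth[OF M m, of x] proj_orth[OF M m, of y] by (simp add: cinner_simps)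
  qed
  have scale: "proj K M (sc a x) = sc a (proj K M x)" for a x
  proof (rule proj_unique[OF M])
    show "sc a (proj K M x) \<in> M"
      using proj_mem[OF M] sub subspace_scale by blast
    fix m assume m: "m \<in> M"
    show "ip (sc a x - sc a (proj K M x)) m = 0"
      using proj_orth[OF M m, of x] by (simp add: cinner_simps)
  qed
  have "nr (proj K M x) \<le> 1 * nr x" for x
  proof -
    have "ip (x - proj K M x) (proj K M x) = 0" by (rule proj_orth[OF M proj_mem[OF M]])
    from Pythagoras[OF this] have "(nr (proj K M x))\<^sup>2 \<le> (nr x)\<^sup>2" by simp
    then show ?thesis using power2_le_imp_le vnorm_ge_0 by simp
  qed
  then show ?thesis unfolding bop_def using add scale by (metis zero_le_one)
qed

lemma clsub_proper_orth:
  assumes M: "clsub K M" and N: "clsub K N" and "M \<subseteq> N" "\<not> N \<subseteq> M"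
  obtains u where "u \<in> N" "u \<noteq> 0" "\<And>m. m \<in> M \<Longrightarrow> ip u m = 0"
proof -
  obtain x where x: "x \<in> N" "x \<notin> M" using assms by blast
  show ?thesis
  proof
    show "x - proj K M x \<in> N"
      using x proj_mem[OF M] assms clsub_subspace subspace_diff by blast
    show "x - proj K M x \<noteq> 0" using x(2) proj_mem[OF M] by (metis right_minus_eq)
    show "ip (x - proj K M x) m = 0" if "m \<in> M" for m
      by (rule proj_orth[OF M that])
  qed
qed

end

text \<open>The scalar field as an inner product space: it turns bounded linear functionals into bounded
  operators.\<close>

definition scalars :: "complex ips" where
  "scalars = \<lparr>cscale = (*), cinner = (\<lambda>x y. x * cnj y)\<rparr>"

interpretation scalars: pos_def_space scalars
  by unfold_locales (auto simp: scalars_def algebra_simps complex_norm_square[symmetric])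

lemma vnorm_scalars [simp]: "vnorm scalars x = cmod x"
  by (simp add: vnorm_def scalars_def complex_norm_square[symmetric])

lemma cscale_scalars [simp]: "cscale scalars = (*)"
  by (simp add: scalars_def)

context hilbert
begin

text \<open>The kernel of \<open>\<phi>\<close> is closed and has codimension at most one, so that a vector orthogonal to it
  represents \<open>\<phi>\<close> up to a scalar.\<close>

theorem Riesz_representation:
  assumes \<phi>: "bop K scalars \<phi>"
  shows "\<exists>z. \<forall>x. \<phi> x = ip x z"
proof (cases "\<forall>x. \<phi> x = 0")
  case True
  then show ?thesis by (intro exI[of _ 0]) simp
next
  case False
  have N: "clsub K {x. \<phi> x = 0}"
    by (rule clsub_kernel[OF scalars.pos_def_space_axioms \<phi>])
  have "\<not> UNIV \<subseteq> {x. \<phi> x = 0}" using False by auto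
  then obtain u where u: "u \<noteq> 0" "\<And>m. \<phi> m = 0 \<Longrightarrow> ip u m = 0"
    using clsub_proper_orth[OF N clsub_UNIV] by auto
  have \<phi>u: "\<phi> u \<noteq> 0" using u(2)[of u] cinner_pos[OF u(1)] by auto
  define r where "r = (nr u)\<^sup>2"
  have r: "r > 0" using u vnorm_pos by (simp add: r_def)
  have "\<phi> x = ip x (sc (cnj (\<phi> u / complex_of_real r)) u)" for x
  proof -
    have "\<phi> (x - sc (\<phi> x / \<phi> u) u) = 0"
      using \<phi>u by (simp add: bop_diff[OF \<phi>] bop_scale[OF \<phi>])
    then have "ip (x - sc (\<phi> x / \<phi> u) u) u = 0"
      using u(2) cinner_eq_0_commute by blast
    then have "ip x u = \<phi> x / \<phi> u * complex_of_real r"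
      by (simp add: cinner_simps cinner_self[of u] r_def)
    then show ?thesis using \<phi>u r unfolding cinner_scale_right by simp
  qed
  then show ?thesis by blast
qed

text \<open>Adjoints, partial isometries and operator power series are all obtained from this
  representation: it replaces convergence of vectors and operators by the construction of a bounded
  sesquilinear form, that is, by estimates for numbers.\<close>

theorem bounded_form_representation:
  assumes L: "pos_def_space L"
    and add_left: "\<And>x x' y. s (x + x') y = s x y + s x' y"
    and scale_left: "\<And>a x y. s (cscale L a x) y = a * s x y"
    and add_right: "\<And>x y y'. s x (y + y') = s x y + s x y'"
    and scale_right: "\<And>a x y. s x (cscale K a y) = cnj a * s x y"
    and c: "c \<ge> 0" and bound: "\<And>x y. cmod (s x y) \<le> c * vnorm L x * nr y"
  shows "\<exists>T. bop L K T \<and> (\<forall>x y. ip (T x) y = s x y)"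
proof -
  interpret L: pos_def_space L by fact
  have "\<exists>z. \<forall>y. cnj (s x y) = ip y z" for x
  proof (rule Riesz_representation)
    show "bop K scalars (\<lambda>y. cnj (s x y))"
      unfolding bop_def using c bound[of x]
      by (auto simp: add_right scale_right intro!: exI[of _ "c * vnorm L x"])
  qed
  then obtain T where "\<And>x y. cnj (s x y) = ip y (T x)" by metis
  then have T: "ip (T x) y = s x y" for x y
    by (metis cinner_hermitian complex_cnj_cnj)
  have "T (x + x') = T x + T x'" for x x'
    by (rule eq_if_cinner_eq) (simp add: T cinner_simps add_left)
  moreover have "T (cscale L a x) = sc a (T x)" for a x
    by (rule eq_if_cinner_eq) (simp add: T cinner_simps scale_left)
  moreover have "nr (T x) \<le> c * vnorm L x" for x
    by (rule vnorm_le_if_functional_le) (use c bound in \<open>simp_all add: T\<close>)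
  ultimately have "bop L K T" unfolding bop_def using c by blast
  with T show ?thesis by blast
qed

end

definition adj :: "'a::ab_group_add ips \<Rightarrow> 'b::ab_group_add ips \<Rightarrow> ('a \<Rightarrow> 'b) \<Rightarrow> 'b \<Rightarrow> 'a" where
  "adj K L T = (SOME S. bop L K S \<and> (\<forall>x y. cinner L (T x) y = cinner K x (S y)))"

lemma adj:
  assumes "hilbert K" "pos_def_space L" "bop K L T"
  shows bop_adj: "bop L K (adj K L T)"
    and cinner_adj: "cinner L (T x) y = cinner K x (adj K L T y)"
proof -
  interpret K: hilbert K by fact
  interpret L: pos_def_space L by fact
  obtain c where c: "c > 0" "\<And>x. vnorm L (T x) \<le> c * vnorm K x"
    using K.bop_bound[OF assms(3)] by metis
  have "\<exists>S. bop L K S \<and> (\<forall>y x. cinner K (S y) x = cinner L y (T x))"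
  proof (rule K.bounded_form_representation[where c = c])
    show "cmod (cinner L y (T x)) \<le> c * vnorm L y * vnorm K x" for y x
    proof -
      have "cmod (cinner L y (T x)) \<le> vnorm L y * vnorm L (T x)" by (rule L.Cauchy_Schwarz)
      also have "\<dots> \<le> vnorm L y * (c * vnorm K x)" by (simp add: c(2) mult_left_mono)
      finally show ?thesis by (simp add: algebra_simps)
    qed
  qed (use c assms in \<open>auto simp: L.cinner_simps bop_add bop_scale L.pos_def_space_axioms\<close>)
  then have "\<exists>S. bop L K S \<and> (\<forall>x y. cinner L (T x) y = cinner K x (S y))"
    by (metis L.cinner_hermitian K.cinner_hermitian)
  from someI_ex[OF this] show "bop L K (adj K L T)"
    and "cinner L (T x) y = cinner K x (adj K L T y)"
    unfolding adj_def by blast+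
qed

section \<open>Orthonormal bases and Hilbert space dimension\<close>

definition orthonormal :: "'a::ab_group_add ips \<Rightarrow> 'a set \<Rightarrow> bool" where
  "orthonormal K B \<longleftrightarrow> (\<forall>b\<in>B. \<forall>c\<in>B. cinner K b c = (if b = c then 1 else 0))"

lemma orthonormalD: "orthonormal K B \<Longrightarrow> b \<in> B \<Longrightarrow> c \<in> B \<Longrightarrow> cinner K b c = (if b = c then 1 else 0)"
  by (simp add: orthonormal_def)

lemma orthonormal_subset: "orthonormal K B \<Longrightarrow> F \<subseteq> B \<Longrightarrow> orthonormal K F"
  unfolding orthonormal_def by (meson subsetD)

text \<open>This is \<^const>\<open>orthonormal_basis\<close> with the norm closure of \<open>K\<close> in place of the strong topology of a
  Krein space.\<close>

definition is_onb :: "'a::ab_group_add ips \<Rightarrow> 'a set \<Rightarrow> 'a set \<Rightarrow> bool" where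
  "is_onb K M B \<longleftrightarrow> orthonormal K B \<and> cl K (module.span (cscale K) B) = M"

context pos_def_space
begin

lemma finite_expansion_orth:
  assumes B: "orthonormal K B" and "finite B" "b \<in> B"
  shows "ip (x - (\<Sum>b\<in>B. sc (ip x b) b)) b = 0"
proof -
  have "ip (\<Sum>b\<in>B. sc (ip x b) b) b = (\<Sum>c\<in>B. if c = b then ip x c else 0)"
    unfolding sum_cinner_left using assms(3)
    by (intro sum.cong) (simp_all add: cinner_scale_left orthonormalD[OF B])
  also have "\<dots> = ip x b" using assms by simp
  finally show ?thesis by (simp add: cinner_simps)
qed

lemma Bessel_finite:
  assumes B: "orthonormal K B" and fin: "finite B"
  shows "(\<Sum>b\<in>B. (cmod (ip x b))\<^sup>2) \<le> (nr x)\<^sup>2"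
proof -
  define p where "p = (\<Sum>b\<in>B. sc (ip x b) b)"
  have "ip p (x - p) = (\<Sum>b\<in>B. ip x b * ip b (x - p))"
    unfolding p_def[THEN arg_cong[of _ _ "\<lambda>q. ip q (x - p)"]] sum_cinner_left
    by (simp add: cinner_scale_left)
  also have "\<dots> = 0"
    by (intro sum.neutral ballI)
      (metis B cinner_eq_0_commute fin finite_expansion_orth mult_zero_right p_def)
  finally have orth: "ip p (x - p) = 0" .
  then have "ip p p = ip p x" by (simp add: cinner_diff_right)
  also have "\<dots> = (\<Sum>b\<in>B. ip x b * cnj (ip x b))"
    unfolding p_def sum_cinner_left by (simp add: cinner_scale_left cinner_hermitian[symmetric])
  also have "\<dots> = complex_of_real (\<Sum>b\<in>B. (cmod (ip x b))\<^sup>2)"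
    by (simp add: complex_norm_square[symmetric])
  finally have "(\<Sum>b\<in>B. (cmod (ip x b))\<^sup>2) = (nr p)\<^sup>2" by (simp add: vnorm_square)
  also have "\<dots> \<le> (nr x)\<^sup>2" using Pythagoras[OF orth] by simp
  finally show ?thesis .
qed

lemma Bessel_summable:
  assumes B: "orthonormal K B"
  shows "(\<lambda>b. (cmod (ip x b))\<^sup>2) summable_on B"
  by (rule nonneg_bdd_above_summable_on)
    (auto intro!: bdd_aboveI2 Bessel_finite orthonormal_subset[OF B])

lemma countable_coefficients:
  assumes B: "orthonormal K B"
  shows "countable {b\<in>B. ip x b \<noteq> 0}"
  using summable_countable_real[OF Bessel_summable[OF B, of x]] by simp

text \<open>The remainder of the finite expansion of \<open>x\<close> lies in the closure of the span of \<open>B\<close> and is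
  orthogonal to it.\<close>

lemma cl_span_finite_onb:
  assumes B: "orthonormal K B" and fin: "finite B"
  shows "cl K (span B) = span B"
proof
  show "cl K (span B) \<subseteq> span B"
  proof
    fix x assume x: "x \<in> cl K (span B)"
    define p where "p = (\<Sum>b\<in>B. sc (ip x b) b)"
    have p: "p \<in> span B" unfolding p_def by (intro span_sum span_scale span_base)
    have "x - p \<in> cl K (span B)"
      using x p subset_cl[of "span B"] subspace_cl[OF subspace_span[of B]] subspace_diff by blast
    moreover have "cl K (span B) \<subseteq> {z. \<forall>y\<in>{x - p}. ip z y = 0}"
    proof (rule cl_span_subset[OF clsub_orth])
      show "B \<subseteq> {z. \<forall>y\<in>{x - p}. ip z y = 0}"
        using finite_expansion_orth[OF B fin, of _ x] cinner_eq_0_commute p_def by auto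
    qed
    ultimately have "ip (x - p) (x - p) = 0" by auto
    then have "x = p" by (metis cinner_self_eq_0D right_minus_eq)
    with p show "x \<in> span B" by simp
  qed
qed (rule subset_cl)

lemma independent_orthonormal:
  assumes B: "orthonormal K B"
  shows "independent B"
  unfolding independent_explicit_finite_subsets
proof (intro allI impI ballI)
  fix S u v assume S: "S \<subseteq> B" "finite S" and 0: "(\<Sum>v\<in>S. sc (u v) v) = 0" and v: "v \<in> S"
  have "ip (\<Sum>v\<in>S. sc (u v) v) v = (\<Sum>w\<in>S. if w = v then u w else 0)"
    unfolding sum_cinner_left
    using S v by (intro sum.cong) (simp_all add: cinner_scale_left orthonormalD[OF B] subset_iff)
  also have "\<dots> = u v" using S v by simp
  finally show "u v = 0" using 0 by simp
qed

end

context hilbert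
begin

text \<open>A maximal orthonormal subset of \<open>M\<close> has dense span, since a unit vector of \<open>M\<close> orthogonal to the
  closure of the span could be added to it.\<close>

lemma onb_exists:
  assumes M: "clsub K M"
  shows "\<exists>B. is_onb K M B"
proof -
  note sub = clsub_subspace[OF M]
  define \<B> where "\<B> = {B. B \<subseteq> M \<and> orthonormal K B}"
  have "\<exists>B\<in>\<B>. \<forall>X\<in>\<B>. B \<subseteq> X \<longrightarrow> X = B"
  proof (rule Zorn_Lemma, intro ballI)
    fix c assume c: "c \<in> chains \<B>"
    then have "c \<subseteq> \<B>" by (simp add: chains_def)
    moreover have "\<exists>X\<in>c. x \<in> X \<and> y \<in> X" if "x \<in> \<Union>c" "y \<in> \<Union>c" for x y
      using that c unfolding chains_def chain_subset_def by blast
    ultimately show "\<Union>c \<in> \<B>"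
      unfolding \<B>_def orthonormal_def by (auto; smt (verit) Union_iff mem_Collect_eq subset_iff)
  qed
  then obtain B where B: "B \<subseteq> M" "orthonormal K B"
    and max: "\<And>X. X \<subseteq> M \<Longrightarrow> orthonormal K X \<Longrightarrow> B \<subseteq> X \<Longrightarrow> X = B"
    unfolding \<B>_def by auto
  have le: "cl K (span B) \<subseteq> M" using M B(1) by (rule cl_span_subset)
  have "M \<subseteq> cl K (span B)"
  proof (rule ccontr)
    assume "\<not> M \<subseteq> cl K (span B)"
    then obtain u where u: "u \<in> M" "u \<noteq> 0" "\<And>m. m \<in> cl K (span B) \<Longrightarrow> ip u m = 0"
      using clsub_proper_orth[OF clsub_cl[OF subspace_span] M le] by blast
    define v where "v = sc (complex_of_real (1 / nr u)) u"
    have n: "nr u > 0" using u vnorm_pos by blast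
    have v: "v \<in> M" using u sub subspace_scale v_def by blast
    have "ip v v = 1" using n u(2)
      by (simp add: v_def cinner_simps cinner_self[of u] power2_eq_square)
    moreover have "ip v b = 0" if "b \<in> B" for b
      using u(3) subset_cl span_base[OF that] by (auto simp: v_def cinner_simps)
    ultimately have "orthonormal K (insert v B)" "v \<notin> B"
      using B(2) cinner_eq_0_commute unfolding orthonormal_def by auto
    then show False using max[of "insert v B"] B(1) v by blast
  qed
  then show ?thesis using le B unfolding is_onb_def by blast
qed

end

text \<open>For infinite bases the comparison is a counting argument: every \<open>T b\<close> has a nonzero
  coefficient with respect to some \<open>c \<in> B'\<close>, while by Bessel's inequality for the vector \<open>T\<^sup>* c\<close> only
  countably many \<open>b\<close> share a given \<open>c\<close>. For finite \<open>B'\<close> the closure disappears and linear algebra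
  applies.\<close>

lemma orthonormal_card_le:
  assumes "hilbert K" "pos_def_space L" and T: "bop K L T"
    and B: "orthonormal K B" and inj: "\<And>x. x \<in> module.span (cscale K) B \<Longrightarrow> T x = 0 \<Longrightarrow> x = 0"
    and B': "orthonormal L B'" and into: "T ` B \<subseteq> cl L (module.span (cscale L) B')"
  shows "|B| \<le>o |B'|"
proof -
  interpret K: hilbert K by fact
  interpret L: pos_def_space L by fact
  show ?thesis
  proof (cases "finite B'")
    case True
    have lin: "Vector_Spaces.linear (cscale K) (cscale L) T"
      using T unfolding Vector_Spaces.linear_iff bop_def
      by (simp add: K.vector_space_axioms L.vector_space_axioms)
    interpret vector_space_pair "cscale K" "cscale L" ..
    have injT: "inj_on T (K.span B)"
    proof (rule inj_onI)
      fix x y assume "x \<in> K.span B" "y \<in> K.span B" "T x = T y"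
      then have "x - y = 0" using inj[of "x - y"] K.span_diff bop_diff[OF T] by simp
      then show "x = y" by simp
    qed
    have "L.independent (T ` B)"
      by (rule linear_independent_injective_image[OF lin K.independent_orthonormal[OF B] injT])
    moreover have "T ` B \<subseteq> L.span B'"
      using into L.cl_span_finite_onb[OF B' True] by simp
    ultimately have *: "finite (T ` B) \<and> card (T ` B) \<le> card B'"
      by (rule L.independent_span_bound[OF True])
    have "inj_on T B" using injT K.span_superset inj_on_subset by blast
    then have "finite B" "card B \<le> card B'"
      using * by (simp_all add: finite_image_iff card_image)
    then show ?thesis
      using True inj_on_iff_card_le[of B B'] card_of_ordLeq by blast
  next
    case False
    define S where "S c = {b\<in>B. cinner K (adj K L T c) b \<noteq> 0}" for c
    have "\<exists>c\<in>B'. b \<in> S c" if b: "b \<in> B" for b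
    proof (rule ccontr)
      assume *: "\<not> (\<exists>c\<in>B'. b \<in> S c)"
      have "cinner L c (T b) = 0" if "c \<in> B'" for c
      proof -
        have "cinner K (adj K L T c) b = 0" using * that b unfolding S_def by blast
        then have "cinner L (T b) c = 0"
          by (metis K.cinner_eq_0_commute K.hilbert_axioms L.pos_def_space_axioms T cinner_adj)
        then show ?thesis by (metis L.cinner_eq_0_commute)
      qed
      then have "cl L (L.span B') \<subseteq> {x. \<forall>z\<in>{T b}. cinner L x z = 0}"
        by (intro L.cl_span_subset L.clsub_orth) auto
      then have "cinner L (T b) (T b) = 0" using into b by blast
      then have "T b = 0" by (rule L.cinner_self_eq_0D)
      then have "b = 0" using inj K.span_base b by blast
      then show False using orthonormalD[OF B b b] by simp
    qed
    then have "B \<subseteq> (\<Union>c\<in>B'. S c)" by blast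
    then have "|B| \<le>o |\<Union>c\<in>B'. S c|" by (rule card_of_mono1)
    also have "|\<Union>c\<in>B'. S c| \<le>o |B'|"
    proof (rule card_of_UNION_ordLeq_infinite[OF False])
      show "\<forall>c\<in>B'. |S c| \<le>o |B'|"
      proof
        fix c
        have "countable (S c)" unfolding S_def by (rule K.countable_coefficients[OF B])
        then have "|S c| \<le>o |UNIV :: nat set|"
          unfolding countable_def using card_of_ordLeq by blast
        also have "|UNIV :: nat set| \<le>o |B'|"
          using False infinite_iff_card_of_nat by blast
        finally show "|S c| \<le>o |B'|" .
      qed
    qed (rule card_of_mono1, rule subset_refl)
    finally show ?thesis .
  qed
qed

lemma onb_card_le:
  assumes "hilbert K" "pos_def_space L" "bop K L T"
    and "is_onb K M B" "is_onb L N B'"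
    and "\<And>x. x \<in> M \<Longrightarrow> T x = 0 \<Longrightarrow> x = 0" "\<And>x. x \<in> M \<Longrightarrow> T x \<in> N"
  shows "|B| \<le>o |B'|"
proof -
  interpret K: hilbert K by fact
  have "K.span B \<subseteq> M" using assms(4) K.subset_cl unfolding is_onb_def by blast
  then show ?thesis
    using assms(4-7) K.span_superset[of B] unfolding is_onb_def
    by (intro orthonormal_card_le[OF assms(1-3)]) (auto simp: image_subset_iff subset_iff)
qed

text \<open>The form \<open>\<Sum>\<^sub>b \<langle>u, b\<rangle> \<langle>\<sigma> b, y\<rangle>\<close> is bounded by the inequalities of Cauchy-Schwarz and Bessel, and
  the operator that represents it is the partial isometry that extends \<open>\<sigma>\<close>. Passing through the form
  avoids infinite sums of vectors.\<close>

lemma bop_extending_orthonormal: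
  assumes "pos_def_space K" "hilbert L" and B: "orthonormal K B" 
    and inj: "inj_on \<sigma> B" and \<sigma>B: "orthonormal L (\<sigma> ` B)"
  shows "\<exists>W. bop K L W \<and> (\<forall>b\<in>B. W b = \<sigma> b)"
proof -
  interpret K: pos_def_space K by fact
  interpret L: hilbert L by fact
  define f where "f u y b = cinner K u b * cinner L (\<sigma> b) y" for u y b
  have fin: "(\<Sum>b\<in>F. cmod (f u y b)) \<le> vnorm K u * vnorm L y" if F: "finite F" "F \<subseteq> B" for u y F
  proof -
    have "(\<Sum>b\<in>F. cmod (f u y b)) = (\<Sum>b\<in>F. \<bar>cmod (cinner K u b)\<bar> * \<bar>cmod (cinner L y (\<sigma> b))\<bar>)"
      unfolding f_def by (intro sum.cong) (auto simp: norm_mult L.cinner_hermitian[of y])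
    also have "\<dots> \<le> L2_set (\<lambda>b. cmod (cinner K u b)) F * L2_set (\<lambda>b. cmod (cinner L y (\<sigma> b))) F"
      by (rule L2_set_mult_ineq)
    also have "\<dots> \<le> vnorm K u * vnorm L y"
    proof (intro mult_mono)
      have "(\<Sum>b\<in>F. (cmod (cinner K u b))\<^sup>2) \<le> (vnorm K u)\<^sup>2"
        using F by (intro K.Bessel_finite orthonormal_subset[OF B])
      then show "L2_set (\<lambda>b. cmod (cinner K u b)) F \<le> vnorm K u"
        unfolding L2_set_def by (rule real_le_lsqrt[OF K.vnorm_ge_0])
      have "(\<Sum>b\<in>F. (cmod (cinner L y (\<sigma> b)))\<^sup>2) = (\<Sum>c\<in>\<sigma> ` F. (cmod (cinner L y c))\<^sup>2)"
        using inj F inj_on_subset by (subst sum.reindex) auto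
      also have "\<dots> \<le> (vnorm L y)\<^sup>2"
        using F by (intro L.Bessel_finite orthonormal_subset[OF \<sigma>B]) auto
      finally show "L2_set (\<lambda>b. cmod (cinner L y (\<sigma> b))) F \<le> vnorm L y"
        unfolding L2_set_def by (rule real_le_lsqrt[OF L.vnorm_ge_0])
    qed auto
    finally show ?thesis .
  qed
  have abs: "(\<lambda>b. norm (f u y b)) summable_on B" for u y
    unfolding abs_summable_iff_bdd_above using fin by (auto intro!: bdd_aboveI2)
  note summ = abs_summable_summable[OF abs]
  have "\<exists>W. bop K L W \<and> (\<forall>u y. cinner L (W u) y = infsum (f u y) B)"
  proof (rule L.bounded_form_representation[where c = 1])
    show "infsum (f (u + u') y) B = infsum (f u y) B + infsum (f u' y) B" for u u' y
      unfolding infsum_add[OF summ summ, symmetric]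
      by (rule infsum_cong) (simp add: f_def K.cinner_simps distrib_right mult.assoc)
    show "infsum (f u (y + y')) B = infsum (f u y) B + infsum (f u y') B" for u y y'
      unfolding infsum_add[OF summ summ, symmetric]
      by (rule infsum_cong) (simp add: f_def L.cinner_simps distrib_left mult.left_commute)
    show "infsum (f (cscale K a u) y) B = a * infsum (f u y) B" for a u y
      unfolding infsum_cmult_right'[symmetric]
      by (rule infsum_cong) (simp add: f_def K.cinner_simps distrib_right mult.assoc)
    show "infsum (f u (cscale L a y)) B = cnj a * infsum (f u y) B" for a u y
      unfolding infsum_cmult_right'[symmetric]
      by (rule infsum_cong) (simp add: f_def L.cinner_simps distrib_left mult.left_commute)
    show "cmod (infsum (f u y) B) \<le> 1 * vnorm K u * vnorm L y" for u y
      using norm_infsum_bound[OF abs, of u y] infsum_le_finite_sums[OF abs fin, of u y] by simp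
  qed (simp_all add: K.pos_def_space_axioms)
  then obtain W where W: "bop K L W" "\<And>u y. cinner L (W u) y = infsum (f u y) B" by blast
  have "W b = \<sigma> b" if b: "b \<in> B" for b
  proof (rule L.eq_if_cinner_eq)
    fix y
    have "infsum (f b y) B = infsum (f b y) {b}"
      by (rule infsum_cong_neutral) (use b orthonormalD[OF B] in \<open>auto simp: f_def\<close>)
    then show "cinner L (W b) y = cinner L (\<sigma> b) y"
      using W b orthonormalD[OF B b b] by (simp add: f_def)
  qed
  with W(1) show ?thesis by blast
qed

section \<open>Square roots by the binomial series\<close>

text \<open>The coefficients of \<open>1 - sqrt (1 - t)\<close> as a power series in \<open>t\<close>.\<close>

definition sqrt_coeff :: "nat \<Rightarrow> real" where
  "sqrt_coeff n = (if n = 0 then 0 else - ((1/2) gchoose n) * (- 1) ^ n)"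

lemma sqrt_coeff_nonneg: "0 \<le> sqrt_coeff n"
proof (cases n)
  case (Suc k)
  have "sqrt_coeff n = - (pochhammer (- (1/2)) (Suc k) / fact (Suc k))"
    unfolding sqrt_coeff_def Suc gbinomial_pochhammer by (simp flip: power_mult_distrib)
  also have "pochhammer (- (1/2) :: real) (Suc k) = - (1/2) * pochhammer (1/2) k"
    by (simp add: pochhammer_rec)
  finally show ?thesis by (simp add: pochhammer_nonneg)
qed (simp add: sqrt_coeff_def)

text \<open>The partial sums of the series of \<open>sqrt (1 - t)\<close> at \<open>t = 1\<close> are themselves, up to sign, binomial
  coefficients and are nonnegative; this gives absolute convergence at the boundary.\<close>

lemma sum_sqrt_coeff_le: "(\<Sum>k\<le>m. sqrt_coeff k) \<le> 1"
proof -
  have "(\<Sum>k\<le>m. sqrt_coeff k) = (\<Sum>k\<le>m. (if k = 0 then 1 else 0) - ((1/2) gchoose k) * (- 1) ^ k)"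
    by (intro sum.cong) (auto simp: sqrt_coeff_def)
  also have "\<dots> = 1 - (- 1) ^ m * ((1/2 - 1) gchoose m)"
    by (simp add: sum_subtractf gbinomial_sum_lower_neg)
  also have "(- 1) ^ m * ((1/2 - 1 :: real) gchoose m) = pochhammer (1/2) m / fact m"
    unfolding gbinomial_pochhammer by (simp flip: power_mult_distrib)
  also have "1 - pochhammer (1/2) m / fact m \<le> (1 :: real)"
    by (simp add: pochhammer_nonneg)
  finally show ?thesis .
qed

text \<open>Comparison of coefficients in \<open>s\<^sup>2 = 2 s - t\<close> for \<open>s = 1 - sqrt (1 - t)\<close>. It follows from the
  Vandermonde identity for \<open>sqrt (1 - t) * sqrt (1 - t) = 1 - t\<close>.\<close>

lemma sqrt_coeff_convolution:
  "(\<Sum>i\<le>k. sqrt_coeff i * sqrt_coeff (k - i)) = 2 * sqrt_coeff k - (if k = 1 then 1 else 0)"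
proof (cases "k = 0")
  case False
  define \<beta> where "\<beta> n = ((1/2 :: real) gchoose n) * (- 1) ^ n" for n
  have \<alpha>: "sqrt_coeff n = (if n = 0 then 1 else 0) - \<beta> n" for n
    by (simp add: sqrt_coeff_def \<beta>_def)
  have "(\<Sum>i\<le>k. \<beta> i * \<beta> (k - i)) = (\<Sum>i\<le>k. (((1/2) gchoose i) * ((1/2) gchoose (k - i))) * (- 1) ^ k)"
    unfolding \<beta>_def by (intro sum.cong) (auto simp: mult.assoc mult.left_commute simp flip: power_add)
  also have "\<dots> = ((1/2 + 1/2) gchoose k) * (- 1) ^ k"
    unfolding sum_distrib_right[symmetric] gbinomial_Vandermonde[symmetric] atLeast0AtMost ..
  also have "\<dots> = of_nat (1 choose k) * (- 1) ^ k"
    unfolding binomial_gbinomial by simp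
  also have "\<dots> = - (if k = 1 then 1 else 0)"
    using False by (cases "k = 1") (auto simp: binomial_eq_0)
  finally have *: "(\<Sum>i\<le>k. \<beta> i * \<beta> (k - i)) = - (if k = 1 then 1 else 0)" .
  have "(\<Sum>i\<le>k. sqrt_coeff i * sqrt_coeff (k - i)) =
      (\<Sum>i\<le>k. (if i = 0 then (if k - i = 0 then 1 else 0) - \<beta> (k - i) else 0)
         - (if k - i = 0 then \<beta> i else 0) + \<beta> i * \<beta> (k - i))"
    unfolding \<alpha> by (intro sum.cong) (auto simp: algebra_simps)
  also have "\<dots> = (\<Sum>i\<le>k. if i = 0 then (if k - i = 0 then 1 else 0) - \<beta> (k - i) else 0)
      - (\<Sum>i\<le>k. if k = i then \<beta> i else 0) + (\<Sum>i\<le>k. \<beta> i * \<beta> (k - i))"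
    unfolding sum.distrib sum_subtractf by (intro arg_cong2[of _ _ _ _ "(+)"] arg_cong2[of _ _ _ _ "(-)"] sum.cong) auto
  also have "\<dots> = - \<beta> k - \<beta> k - (if k = 1 then 1 else 0)"
    using False unfolding * by simp
  finally show ?thesis using False by (simp add: \<alpha>)
qed (simp add: sqrt_coeff_def)

lemma summable_sqrt_coeff: "sqrt_coeff summable_on UNIV"
  and infsum_sqrt_coeff_le: "infsum sqrt_coeff UNIV \<le> 1"
proof -
  have fin: "sum sqrt_coeff F \<le> 1" if "finite F" for F
  proof -
    obtain m where "F \<subseteq> {..m}" using \<open>finite F\<close> finite_nat_iff_bounded_le by blast
    then have "sum sqrt_coeff F \<le> (\<Sum>k\<le>m. sqrt_coeff k)"
      by (intro sum_mono2) (auto simp: sqrt_coeff_nonneg)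
    then show ?thesis using sum_sqrt_coeff_le[of m] by simp
  qed
  show *: "sqrt_coeff summable_on UNIV"
    by (rule nonneg_bdd_above_summable_on) (auto intro!: bdd_aboveI2 fin sqrt_coeff_nonneg)
  show "infsum sqrt_coeff UNIV \<le> 1"
    using infsum_le_finite_sums[OF *] fin by blast
qed

text \<open>With \<open>z k = \<langle>X\<^sup>k x, y\<rangle>\<close> this squares a power series of an operator \<open>X\<close> at the level of forms.\<close>

lemma infsum_convolution:
  fixes \<alpha> :: "nat \<Rightarrow> real" and z :: "nat \<Rightarrow> complex"
  assumes \<alpha>: "\<alpha> summable_on UNIV" "\<And>n. \<alpha> n \<ge> 0" and z: "\<And>n. cmod (z n) \<le> Z"
  shows "(\<Sum>\<^sub>\<infinity>m. \<alpha> m * (\<Sum>\<^sub>\<infinity>n. \<alpha> n * z (n + m))) =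
    (\<Sum>\<^sub>\<infinity>k. (\<Sum>i\<le>k. \<alpha> i * \<alpha> (k - i)) * z k)"
proof -
  define g where "g = (\<lambda>(m, n). complex_of_real (\<alpha> m * \<alpha> n) * z (n + m))"
  have "(\<lambda>(m, n). \<alpha> m * \<alpha> n) summable_on (UNIV \<times> UNIV)"
  proof (rule summable_on_SigmaI)
    show "((\<lambda>n. case (m, n) of (m, n) \<Rightarrow> \<alpha> m * \<alpha> n) has_sum \<alpha> m * infsum \<alpha> UNIV) UNIV" for m
      using has_sum_cmult_right[OF has_sum_infsum[OF \<alpha>(1)]] by simp
    show "(\<lambda>m. \<alpha> m * infsum \<alpha> UNIV) summable_on UNIV"
      using summable_on_cmult_left[OF \<alpha>(1)] by simp
  qed (simp add: \<alpha>)
  then have "(\<lambda>p. (\<lambda>(m, n). \<alpha> m * \<alpha> n) p * Z) summable_on (UNIV \<times> UNIV)"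
    by (rule summable_on_cmult_left)
  then have "(\<lambda>p. norm (g p)) summable_on (UNIV \<times> UNIV)"
    by (rule summable_on_comparison_test)
      (auto simp: g_def norm_mult \<alpha> z abs_mult intro!: mult_left_mono mult_nonneg_nonneg)
  then have g: "g summable_on (UNIV \<times> UNIV)" by (rule abs_summable_summable)
  have "(\<Sum>\<^sub>\<infinity>m. \<alpha> m * (\<Sum>\<^sub>\<infinity>n. \<alpha> n * z (n + m))) = (\<Sum>\<^sub>\<infinity>m. \<Sum>\<^sub>\<infinity>n. g (m, n))"
    unfolding infsum_cmult_right'[symmetric] by (simp add: g_def mult.assoc)
  also have "\<dots> = infsum g (UNIV \<times> UNIV)"
    by (rule infsum_Sigma_banach[OF g])
  also have "\<dots> = infsum (\<lambda>(k, i). g (i, k - i)) (SIGMA k:UNIV. {..k})"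
    by (rule infsum_reindex_bij_witness[where j = "\<lambda>(m, n). (n + m, m)" and i = "\<lambda>(k, i). (i, k - i)"])
      auto
  also have "\<dots> = (\<Sum>\<^sub>\<infinity>k. \<Sum>\<^sub>\<infinity>i\<in>{..k}. g (i, k - i))"
  proof -
    have "(\<lambda>(k, i). g (i, k - i)) summable_on (SIGMA k:UNIV. {..k}) \<longleftrightarrow> g summable_on (UNIV \<times> UNIV)"
      by (rule summable_on_reindex_bij_witness[where i = "\<lambda>(m, n). (n + m, m)" and j = "\<lambda>(k, i). (i, k - i)"])
        auto
    from infsum_Sigma_banach[OF this[THEN iffD2, OF g]] show ?thesis by simp
  qed
  also have "\<dots> = (\<Sum>\<^sub>\<infinity>k. (\<Sum>i\<le>k. \<alpha> i * \<alpha> (k - i)) * z k)"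
    by (intro infsum_cong) (simp add: g_def sum_distrib_right)
  finally show ?thesis .
qed

definition selfadj :: "'a::ab_group_add ips \<Rightarrow> ('a \<Rightarrow> 'a) \<Rightarrow> bool" where
  "selfadj K X \<longleftrightarrow> bop K K X \<and> (\<forall>x y. cinner K (X x) y = cinner K x (X y))"

lemma selfadj_bop: "selfadj K X \<Longrightarrow> bop K K X"
  and selfadjD: "selfadj K X \<Longrightarrow> cinner K (X x) y = cinner K x (X y)"
  by (simp_all add: selfadj_def)

context hilbert
begin

lemma eq_0_if_selfadj_square_0:
  assumes "selfadj K X" "X (X x) = 0"
  shows "X x = 0"
proof -
  have "ip (X x) (X x) = 0" using selfadjD[OF assms(1), of x "X x"] assms(2) by simp
  then show ?thesis by (rule cinner_self_eq_0D)
qed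

text \<open>With \<open>\<alpha>\<close> the coefficients of \<open>1 - sqrt (1 - t)\<close>, the operator \<open>Y = \<Sum>\<^sub>n \<alpha>\<^sub>n X\<^sup>n\<close> is defined through
  its form, so that only absolutely convergent series of numbers occur. It is again a contraction,
  which permits the construction to be repeated for a fourth root.\<close>

theorem one_minus_sqrt:
  assumes X: "selfadj K X" and contr: "\<And>x. nr (X x) \<le> nr x"
  obtains Y where "selfadj K Y" "\<And>x. nr (Y x) \<le> nr x" "\<And>x. Y (Y x) = Y x + Y x - X x"
    "\<And>D x. bop K K D \<Longrightarrow> (\<And>x. D (X x) = X (D x)) \<Longrightarrow> D (Y x) = Y (D x)"
proof -
  note bX = selfadj_bop[OF X]
  have pow: "bop K K (X ^^ n)" for n
  proof (induction n)
    case 0 show ?case using bop_id by (simp add: id_def)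
  next
    case (Suc n) show ?case using bop_comp[OF Suc bX] by (simp add: comp_def)
  qed
  have pow_contr: "nr ((X ^^ n) x) \<le> nr x" for n x
    by (induction n) (auto intro: order_trans[OF contr])
  have pow_adj: "ip ((X ^^ n) x) y = ip x ((X ^^ n) y)" for n x y
    by (induction n arbitrary: x y) (simp_all add: selfadjD[OF X] funpow_swap1)
  define t where "t x y n = complex_of_real (sqrt_coeff n) * ip ((X ^^ n) x) y" for x y n
  have z_bound: "cmod (ip ((X ^^ n) x) y) \<le> nr x * nr y" for n x y
    using Cauchy_Schwarz pow_contr vnorm_ge_0 by (meson mult_right_mono order_trans)
  have t_bound: "norm (t x y n) \<le> sqrt_coeff n * (nr x * nr y)" for x y n
    unfolding t_def by (simp add: norm_mult sqrt_coeff_nonneg mult_left_mono z_bound)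
  have maj: "(\<lambda>n. sqrt_coeff n * (nr x * nr y)) summable_on UNIV" for x y
    by (rule summable_on_cmult_left[OF summable_sqrt_coeff])
  have abs: "(\<lambda>n. norm (t x y n)) summable_on UNIV" for x y
    by (rule summable_on_comparison_test[OF maj[of x y]]) (use t_bound in auto)
  note summ = abs_summable_summable[OF abs]
  have bound: "cmod (infsum (t x y) UNIV) \<le> 1 * nr x * nr y" for x y
  proof -
    have "cmod (infsum (t x y) UNIV) \<le> (\<Sum>\<^sub>\<infinity>n. norm (t x y n))" by (rule norm_infsum_bound[OF abs])
    also have "\<dots> \<le> (\<Sum>\<^sub>\<infinity>n. sqrt_coeff n * (nr x * nr y))"
      by (rule infsum_mono[OF abs maj t_bound])
    also have "\<dots> = infsum sqrt_coeff UNIV * (nr x * nr y)" by (rule infsum_cmult_left')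
    also have "\<dots> \<le> 1 * (nr x * nr y)"
      using infsum_sqrt_coeff_le by (intro mult_right_mono) auto
    finally show ?thesis by simp
  qed
  have "\<exists>Y. bop K K Y \<and> (\<forall>x y. ip (Y x) y = infsum (t x y) UNIV)"
  proof (rule bounded_form_representation[where c = 1])
    show "infsum (t (x + x') y) UNIV = infsum (t x y) UNIV + infsum (t x' y) UNIV" for x x' y
      unfolding infsum_add[OF summ summ, symmetric]
      by (rule infsum_cong) (simp add: t_def cinner_simps distrib_left bop_add[OF pow])
    show "infsum (t x (y + y')) UNIV = infsum (t x y) UNIV + infsum (t x y') UNIV" for x y y'
      unfolding infsum_add[OF summ summ, symmetric]
      by (rule infsum_cong) (simp add: t_def cinner_simps distrib_left)
    show "infsum (t (sc a x) y) UNIV = a * infsum (t x y) UNIV" for a x y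
      unfolding infsum_cmult_right'[symmetric]
      by (rule infsum_cong) (simp add: t_def cinner_simps mult.left_commute bop_scale[OF pow])
    show "infsum (t x (sc a y)) UNIV = cnj a * infsum (t x y) UNIV" for a x y
      unfolding infsum_cmult_right'[symmetric]
      by (rule infsum_cong) (simp add: t_def cinner_simps mult.left_commute)
  qed (use bound in \<open>simp_all add: pos_def_space_axioms\<close>)
  then obtain Y where bY: "bop K K Y" and Y: "\<And>x y. ip (Y x) y = infsum (t x y) UNIV" by blast
  have comm: "D (Y x) = Y (D x)" if D: "bop K K D" and DX: "\<And>x. D (X x) = X (D x)" for D x
  proof (rule eq_if_cinner_eq)
    fix y
    have DXn: "D ((X ^^ n) x) = (X ^^ n) (D x)" for n
      by (induction n) (simp_all add: DX)
    have "ip (D (Y x)) y = infsum (t x (adj K K D y)) UNIV"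
      by (simp add: cinner_adj[OF hilbert_axioms pos_def_space_axioms D] Y)
    also have "t x (adj K K D y) = t (D x) y"
      by (simp add: fun_eq_iff t_def cinner_adj[OF hilbert_axioms pos_def_space_axioms D, symmetric] DXn)
    finally show "ip (D (Y x)) y = ip (Y (D x)) y" by (simp add: Y)
  qed
  show thesis
  proof
    have "ip (Y x) y = ip x (Y y)" for x y
    proof -
      have "ip (Y x) y = (\<Sum>\<^sub>\<infinity>n. cnj (t y x n))"
        unfolding Y by (intro infsum_cong) (simp add: t_def pow_adj cinner_hermitian[symmetric])
      also have "\<dots> = cnj (ip (Y y) x)" unfolding Y by (rule infsum_cnj)
      finally show ?thesis by (simp add: cinner_hermitian[symmetric])
    qed
    with bY show "selfadj K Y" by (simp add: selfadj_def)
    show "nr (Y x) \<le> nr x" for x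
      by (rule vnorm_le_if_functional_le) (use bound in \<open>simp_all add: Y\<close>)
    show "D (Y x) = Y (D x)" if "bop K K D" "\<And>x. D (X x) = X (D x)" for D x
      using that by (rule comm)
    show "Y (Y x) = Y x + Y x - X x" for x
    proof (rule eq_if_cinner_eq)
      fix y
      let ?z = "\<lambda>n. ip ((X ^^ n) x) y"
      have "ip (Y (Y x)) y = (\<Sum>\<^sub>\<infinity>m. complex_of_real (sqrt_coeff m) * ip (Y ((X ^^ m) x)) y)"
        unfolding Y[of "Y x"] t_def
        by (simp add: comm[OF pow] funpow_swap1)
      also have "\<dots> = (\<Sum>\<^sub>\<infinity>m. sqrt_coeff m * (\<Sum>\<^sub>\<infinity>n. sqrt_coeff n * ?z (n + m)))"
        unfolding Y t_def by (simp add: funpow_add)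
      also have "\<dots> = (\<Sum>\<^sub>\<infinity>k. (\<Sum>i\<le>k. sqrt_coeff i * sqrt_coeff (k - i)) * ?z k)"
        by (rule infsum_convolution[OF summable_sqrt_coeff sqrt_coeff_nonneg z_bound])
      also have "\<dots> = (\<Sum>\<^sub>\<infinity>k. 2 * t x y k + (if k = 1 then - ip (X x) y else 0))"
        unfolding sqrt_coeff_convolution by (intro infsum_cong) (auto simp: t_def algebra_simps)
      also have "\<dots> = (\<Sum>\<^sub>\<infinity>k. 2 * t x y k) + (\<Sum>\<^sub>\<infinity>k::nat. if k = 1 then - ip (X x) y else 0)"
      proof (rule infsum_add)
        show "(\<lambda>k. 2 * t x y k) summable_on UNIV" by (rule summable_on_cmult_right[OF summ])
        have "(\<lambda>k::nat. - ip (X x) y) summable_on {1}" by simp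
        then show "(\<lambda>k::nat. if k = 1 then - ip (X x) y else 0) summable_on UNIV"
          by (rule summable_on_cong_neutral[THEN iffD1, rotated -1]) auto
      qed
      also have "(\<Sum>\<^sub>\<infinity>k::nat. if k = 1 then - ip (X x) y else 0) = (\<Sum>\<^sub>\<infinity>k\<in>{1::nat}. - ip (X x) y)"
        by (rule infsum_cong_neutral) auto
      also have "(\<Sum>\<^sub>\<infinity>k. 2 * t x y k) = 2 * ip (Y x) y"
        unfolding Y by (rule infsum_cmult_right')
      finally show "ip (Y (Y x)) y = ip (Y x + Y x - X x) y"
        by (simp add: cinner_simps)
    qed
  qed
qed

end

section \<open>Splitting a selfadjoint operator into its positive and negative parts\<close>

text \<open>\<open>P\<close> and \<open>N\<close> are the closures of the ranges of the positive and negative parts of \<open>G\<close>, and \<open>R\<close> is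
  a selfadjoint square root of the modulus of \<open>G\<close>.\<close>

definition spectral_split ::
    "'a::ab_group_add ips \<Rightarrow> ('a \<Rightarrow> 'a) \<Rightarrow> 'a set \<Rightarrow> 'a set \<Rightarrow> ('a \<Rightarrow> 'a) \<Rightarrow> bool" where
  "spectral_split K G P N R \<longleftrightarrow>
     clsub K P \<and> clsub K N \<and> selfadj K R \<and>
     (\<forall>p\<in>P. \<forall>n\<in>N. cinner K p n = 0) \<and>
     (\<forall>z. G z = 0 \<longrightarrow> (\<forall>x\<in>P \<union> N. cinner K z x = 0)) \<and>
     (\<forall>x. \<exists>p\<in>P. \<exists>n\<in>N. \<exists>z. G z = 0 \<and> x = p + n + z) \<and>
     (\<forall>p\<in>P. R p \<in> P \<and> R (R p) = G p) \<and>
     (\<forall>n\<in>N. R n \<in> N \<and> R (R n) = - G n) \<and>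
     (\<forall>x. R x = 0 \<longleftrightarrow> G x = 0)"

context hilbert
begin

text \<open>The modulus \<open>T\<close> of \<open>G\<close> is the square root of \<open>G\<^sup>2 = 1 - X\<close>, and \<open>R\<close> is the square root of \<open>T\<close>.
  Since both commute with \<open>G\<close>, the identity \<open>(T - G) (T + G) = 0\<close> splits the space into \<open>E\<close>, where
  \<open>G = T\<close>, and its orthogonal complement, where \<open>G = - T\<close>. The kernel of \<open>G\<close> lies in \<open>E\<close> and is split
  off to obtain \<open>P\<close>.\<close>

lemma spectral_split_contraction:
  assumes G: "selfadj K G" and contr: "\<And>x. nr (G x) \<le> nr x"
  shows "\<exists>P N R. spectral_split K G P N R"
proof -
  note bG = selfadj_bop[OF G] and aG = selfadjD[OF G]
  define X where "X x = x - G (G x)" for x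
  have X: "selfadj K X"
    unfolding selfadj_def X_def
    using bop_diff_fun[OF bop_id bop_comp[OF bG bG]] by (simp add: cinner_simps aG)
  have "nr (X x) \<le> nr x" for x
  proof -
    have "ip x (G (G x)) = ip (G x) (G x)" by (rule aG[symmetric])
    then have "(nr (X x))\<^sup>2 = (nr x)\<^sup>2 - 2 * (nr (G x))\<^sup>2 + (nr (G (G x)))\<^sup>2"
      unfolding X_def vnorm_diff_square by (simp add: vnorm_square[symmetric])
    also have "\<dots> \<le> (nr x)\<^sup>2"
      using power_mono[OF contr[of "G x"] vnorm_ge_0, of 2] zero_le_power2[of "nr (G x)"] by linarith
    finally show ?thesis using power2_le_imp_le vnorm_ge_0 by blast
  qed
  then obtain Y where Y: "selfadj K Y" "\<And>x. nr (Y x) \<le> nr x" "\<And>x. Y (Y x) = Y x + Y x - X x"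
    and Yc: "\<And>D x. bop K K D \<Longrightarrow> (\<And>x. D (X x) = X (D x)) \<Longrightarrow> D (Y x) = Y (D x)"
    using one_minus_sqrt[OF X] by metis
  obtain Z where Z: "selfadj K Z" "\<And>x. Z (Z x) = Z x + Z x - Y x"
    and Zc: "\<And>D x. bop K K D \<Longrightarrow> (\<And>x. D (Y x) = Y (D x)) \<Longrightarrow> D (Z x) = Z (D x)"
    using one_minus_sqrt[OF Y(1,2)] by metis
  \<comment> \<open>\<open>T\<close> is the modulus of \<open>G\<close>, and \<open>R\<close> its square root.\<close>
  define T where "T x = x - Y x" for x
  define R where "R x = x - Z x" for x
  note bY = selfadj_bop[OF Y(1)] and bZ = selfadj_bop[OF Z(1)]
  have GY: "G (Y x) = Y (G x)" for x
    by (rule Yc[OF bG]) (simp add: X_def bop_diff[OF bG])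
  have GZ: "G (Z x) = Z (G x)" for x
    by (rule Zc[OF bG GY])
  have T: "selfadj K T" and R: "selfadj K R"
    unfolding selfadj_def T_def R_def
    using bop_diff_fun[OF bop_id bY] bop_diff_fun[OF bop_id bZ]
    by (simp_all add: cinner_simps selfadjD[OF Y(1)] selfadjD[OF Z(1)])
  note bT = selfadj_bop[OF T] and bR = selfadj_bop[OF R]
  have TT: "T (T x) = G (G x)" for x
    by (simp add: T_def bop_diff[OF bY] Y(3) X_def)
  have RR: "R (R x) = T x" for x
    by (simp add: R_def T_def bop_diff[OF bZ] Z(2))
  have GT: "G (T x) = T (G x)" for x by (simp add: T_def bop_diff[OF bG] GY)
  have GR: "G (R x) = R (G x)" for x by (simp add: R_def bop_diff[OF bG] GZ)
  have TR: "T (R x) = R (T x)" for x by (simp add: RR[symmetric])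
  have kerG: "G x = 0 \<longleftrightarrow> R x = 0" for x
  proof
    assume "G x = 0"
    then have "T (T x) = 0" by (simp add: TT bop_zero[OF bG])
    then have "R (R x) = 0" using eq_0_if_selfadj_square_0[OF T] RR by simp
    then show "R x = 0" by (rule eq_0_if_selfadj_square_0[OF R])
  next
    assume "R x = 0"
    then have "G (G x) = 0" by (metis TT RR bop_zero[OF bR])
    then show "G x = 0" by (rule eq_0_if_selfadj_square_0[OF G])
  qed
  define E where "E = {x. G x = T x}"
  define P where "P = E \<inter> {x. \<forall>z\<in>{z. G z = 0}. ip x z = 0}"
  define N where "N = {x. \<forall>e\<in>E. ip x e = 0}"
  have E: "clsub K E" unfolding E_def by (rule clsub_equalizer[OF pos_def_space_axioms bG bT])
  have kerE: "z \<in> E" if "G z = 0" for z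
  proof -
    have "T z = 0" using that kerG RR by (metis bop_zero[OF bR])
    with that show ?thesis by (simp add: E_def)
  qed
  have clP: "clsub K P" unfolding P_def by (rule clsub_Int[OF E clsub_orth])
  have clN: "clsub K N" unfolding N_def by (rule clsub_orth)
  have PN: "ip p n = 0" if "p \<in> P" "n \<in> N" for p n
    using that cinner_eq_0_commute unfolding P_def N_def by blast
  have ker: "ip z x = 0" if "G z = 0" "x \<in> P \<union> N" for z x
    using that kerE cinner_eq_0_commute unfolding P_def N_def by blast
  have decomp: "\<exists>p\<in>P. \<exists>n\<in>N. \<exists>z. G z = 0 \<and> x = p + n + z" for x
  proof -
    have kercl: "clsub K {z. G z = 0}" by (rule clsub_kernel[OF pos_def_space_axioms bG])
    define z where "z = proj K {z. G z = 0} x"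
    have z: "G z = 0" using proj_mem[OF kercl] by (simp add: z_def)
    define p where "p = proj K E (x - z)"
    have n: "x - z - p \<in> N" unfolding N_def p_def using proj_orth[OF E] by blast
    have "ip p y = 0" if y: "G y = 0" for y
    proof -
      have "ip (x - z) y = 0" using proj_orth[OF kercl] y by (simp add: z_def)
      moreover have "ip (x - z - p) y = 0" using n kerE[OF y] by (simp add: N_def)
      ultimately show ?thesis by (simp add: cinner_simps)
    qed
    then have "p \<in> P" unfolding P_def p_def using proj_mem[OF E] by auto
    then show ?thesis using n z by (intro bexI[of _ p] bexI[of _ "x - z - p"] exI[of _ z]) auto
  qed
  have RE: "R e \<in> E" if "e \<in> E" for e
    using that by (simp add: E_def GR TR)
  have RP: "R p \<in> P \<and> R (R p) = G p" if p: "p \<in> P" for p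
  proof
    have "ip (R p) z = 0" if "G z = 0" for z
      using that kerG by (simp add: selfadjD[OF R])
    then show "R p \<in> P" using p RE by (simp add: P_def)
    show "R (R p) = G p" using p by (simp add: RR P_def E_def)
  qed
  have RN: "R n \<in> N \<and> R (R n) = - G n" if n: "n \<in> N" for n
  proof
    show "R n \<in> N" using n RE by (simp add: N_def selfadjD[OF R])
    \<comment> \<open>\<open>(T - G) (T + G) = 0\<close>, so that \<open>T + G\<close> maps everything into \<open>E\<close>.\<close>
    have into: "T x + G x \<in> E" for x
      by (simp add: E_def bop_add[OF bG] bop_add[OF bT] GT TT)
    have "ip (T n + G n) (T n + G n) = ip n (T (T n + G n) + G (T n + G n))"
      by (simp add: selfadjD[OF T] aG cinner_simps bop_add[OF bG] bop_add[OF bT])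
    also have "\<dots> = 0" using n into unfolding N_def by blast
    finally have "T n + G n = 0" by (rule cinner_self_eq_0D)
    then show "R (R n) = - G n" unfolding RR by (simp add: eq_neg_iff_add_eq_0)
  qed
  have "spectral_split K G P N R"
    unfolding spectral_split_def using clP clN R PN ker decomp RP RN kerG by blast
  then show ?thesis by blast
qed

theorem spectral_split_exists:
  assumes G: "selfadj K G"
  shows "\<exists>P N R. spectral_split K G P N R"
proof -
  obtain c where c: "c > 0" "\<And>x. nr (G x) \<le> c * nr x"
    using bop_bound[OF selfadj_bop[OF G]] by metis
  define G' where "G' x = sc (complex_of_real (1/c)) (G x)" for x
  have G': "selfadj K G'"
    unfolding selfadj_def G'_def
    using bop_scale_fun[OF selfadj_bop[OF G]] by (simp add: cinner_simps selfadjD[OF G])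
  have "nr (G' x) \<le> nr x" for x
  proof -
    have "nr (G' x) = nr (G x) / c" using c by (simp add: G'_def vnorm_scale norm_divide)
    then show ?thesis using c by (simp add: pos_divide_le_eq mult.commute)
  qed
  then obtain P N R where s: "spectral_split K G' P N R"
    using spectral_split_contraction[OF G'] by blast
  define a where "a = complex_of_real (sqrt c)"
  have a: "a * a = complex_of_real c" "a \<noteq> 0" "cnj a = a"
    using c by (auto simp: a_def simp flip: of_real_mult)
  have G: "G x = sc (a * a) (G' x)" for x
    using c by (simp add: a G'_def)
  then have kerG: "G x = 0 \<longleftrightarrow> G' x = 0" for x
    using a(2) by (metis mult_eq_0_iff scale_eq_0_iff)
  define R' where "R' x = sc a (R x)" for x
  have R: "selfadj K R" using s by (simp add: spectral_split_def)
  have "selfadj K R'"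
    unfolding selfadj_def R'_def
    using bop_scale_fun[OF selfadj_bop[OF R]] by (simp add: cinner_simps selfadjD[OF R] a)
  moreover have "R' (R' x) = sc (a * a) (R (R x))" for x
    by (simp add: R'_def bop_scale[OF selfadj_bop[OF R]])
  moreover have "R' x = 0 \<longleftrightarrow> R x = 0" for x using a by (simp add: R'_def)
  moreover have "x \<in> P \<Longrightarrow> sc b x \<in> P" "x \<in> N \<Longrightarrow> sc b x \<in> N" for x b
    using s clsub_subspace subspace_scale unfolding spectral_split_def by blast+
  ultimately have "spectral_split K G P N R'"
    using s unfolding spectral_split_def kerG by (simp add: G R'_def)
  then show ?thesis by blast
qed

end

text \<open>The definition of \<^const>\<open>spectral_split\<close> is symmetric under \<open>G \<mapsto> - G\<close> with \<open>P\<close> and \<open>N\<close>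
  exchanged. Hence dimensions are computed for \<open>P\<close> only, and those of \<open>N\<close> are instances.\<close>

locale spectral = hilbert K for K :: "'a::ab_group_add ips" +
  fixes G P N R
  assumes split: "spectral_split K G P N R" and selfadj_G: "selfadj K G"
begin

lemma clsub_P: "clsub K P" and clsub_N: "clsub K N" and selfadj_R: "selfadj K R"
  using split by (simp_all add: spectral_split_def)

lemma P_orth_N: "p \<in> P \<Longrightarrow> n \<in> N \<Longrightarrow> ip p n = 0"
  using split by (simp add: spectral_split_def)

lemma ker_orth: "G z = 0 \<Longrightarrow> x \<in> P \<union> N \<Longrightarrow> ip z x = 0"
  using split by (simp add: spectral_split_def)

lemma decomposition:
  obtains p n z where "p \<in> P" "n \<in> N" "G z = 0" "x = p + n + z"
  using split unfolding spectral_split_def by blast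

lemma R_P: "p \<in> P \<Longrightarrow> R p \<in> P" "p \<in> P \<Longrightarrow> R (R p) = G p"
  and R_N: "n \<in> N \<Longrightarrow> R n \<in> N" "n \<in> N \<Longrightarrow> R (R n) = - G n"
  and R_eq_0: "R x = 0 \<longleftrightarrow> G x = 0"
  using split by (simp_all add: spectral_split_def)

lemma spectral_uminus: "spectral K (\<lambda>x. - G x) N P R"
proof unfold_locales
  show "spectral_split K (\<lambda>x. - G x) N P R"
    using split cinner_eq_0_commute unfolding spectral_split_def
    by (simp add: Un_commute) (metis add.commute)
  show "selfadj K (\<lambda>x. - G x)"
    using selfadj_G bop_uminus_fun[of K G] unfolding selfadj_def by (simp add: cinner_simps)
qed

lemma G_form_P: "p \<in> P \<Longrightarrow> Re (ip (G p) p) = (nr (R p))\<^sup>2"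
  using selfadjD[OF selfadj_R, of "R p" p] R_P(2)[of p] by (simp add: vnorm_square)

lemma G_form_N: "n \<in> N \<Longrightarrow> Re (ip (G n) n) = - (nr (R n))\<^sup>2"
proof -
  assume "n \<in> N"
  then have "- ip (G n) n = ip (R n) (R n)"
    using selfadjD[OF selfadj_R, of "R n" n] R_N(2)[of n] by (simp add: cinner_minus_left)
  then have "ip (G n) n = - ip (R n) (R n)" by (metis minus_minus)
  then show ?thesis by (simp add: vnorm_square)
qed

lemma G_pos:
  assumes "p \<in> P" "p \<noteq> 0"
  shows "0 < Re (ip (G p) p)"
proof -
  have "R p \<noteq> 0"
    using assms ker_orth[of p p] cinner_pos[of p] R_eq_0 by auto
  then show ?thesis using assms vnorm_pos by (simp add: G_form_P)
qed

text \<open>Off \<open>P\<close> the form of \<open>G\<close> is nonpositive, so the projection onto \<open>P\<close> is injective on every strictly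
  positive subspace.\<close>

lemma proj_P_eq_0_imp_nonpos:
  assumes "proj K P x = 0"
  shows "Re (ip (G x) x) \<le> 0"
proof -
  obtain p n z where x: "p \<in> P" "n \<in> N" "G z = 0" "x = p + n + z" by (rule decomposition)
  have "ip x p = 0" using proj_eq_0D[OF clsub_P assms] x by blast
  moreover have "ip n p = 0" "ip z p = 0"
    using x P_orth_N ker_orth cinner_eq_0_commute by blast+
  ultimately have "ip p p = 0" by (simp add: x(4) cinner_simps)
  then have "p = 0" by (rule cinner_self_eq_0D)
  then have xn: "x = n + z" using x by simp
  have bG: "bop K K G" by (rule selfadj_bop[OF selfadj_G])
  have "ip (G n) z = 0" using selfadjD[OF selfadj_G, of n z] x by simp
  then have "ip (G x) x = ip (G n) n"
    unfolding xn using x by (simp add: bop_add[OF bG] cinner_simps)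
  then show ?thesis using G_form_N[OF x(2)] by simp
qed

lemma strictly_positive_card_le:
  assumes "is_onb K M B" "\<And>x. x \<in> M \<Longrightarrow> x \<noteq> 0 \<Longrightarrow> 0 < Re (ip (G x) x)" "is_onb K P B'"
  shows "|B| \<le>o |B'|"
  by (rule onb_card_le[OF hilbert_axioms pos_def_space_axioms bop_proj[OF clsub_P] assms(1,3)])
    (use assms(2) proj_P_eq_0_imp_nonpos proj_mem[OF clsub_P] in \<open>force+\<close>)

end

section \<open>Factorizations through a Hilbert space with a fundamental symmetry\<close>

text \<open>A Krein space is a Hilbert space \<open>L\<close> with a selfadjoint involution \<open>J\<close>: its indefinite inner product
  is \<open>\<langle>J x, y\<rangle>\<close>, and the eigenspaces of \<open>J\<close> form a fundamental decomposition.\<close>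

locale fundamental_symmetry = L: hilbert L for L :: "'b::ab_group_add ips" +
  fixes J :: "'b \<Rightarrow> 'b"
  assumes selfadj_J: "selfadj L J" and J_J [simp]: "J (J x) = x"
begin

abbreviation "Lpos \<equiv> {x. J x = x}"
abbreviation "Lneg \<equiv> {x. J x = - x}"

lemma bop_J: "bop L L J"
  by (rule selfadj_bop[OF selfadj_J])

lemmas J_simps = bop_add[OF bop_J] bop_diff[OF bop_J] bop_scale[OF bop_J] bop_minus[OF bop_J]

lemma vnorm_J: "L.nr (J x) = L.nr x"
  using selfadjD[OF selfadj_J, of x "J x"] by (simp add: vnorm_def)

lemma clsub_Lpos: "clsub L Lpos"
  by (rule L.clsub_equalizer[OF L.pos_def_space_axioms bop_J L.bop_id])

lemma clsub_Lneg: "clsub L Lneg"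
  by (rule L.clsub_equalizer[OF L.pos_def_space_axioms bop_J L.bop_uminus_fun[OF L.bop_id]])

lemma Lpos_orth_Lneg: "J x = x \<Longrightarrow> J y = - y \<Longrightarrow> L.ip x y = 0"
  using selfadjD[OF selfadj_J, of x y] by (simp add: L.cinner_simps)

lemma Lpos_Lneg_decomposition:
  obtains p n where "J p = p" "J n = - n" "x = p + n"
proof
  show "J (L.sc (1/2) (x + J x)) = L.sc (1/2) (x + J x)"
    by (simp add: J_simps add.commute)
  show "J (L.sc (1/2) (x - J x)) = - L.sc (1/2) (x - J x)"
    by (simp add: J_simps L.scale_minus_right[symmetric])
  have "L.sc (1/2) (x + J x) + L.sc (1/2) (x - J x) = L.sc (1/2 + 1/2) x"
    unfolding L.scale_left_distrib by (simp add: L.scale_right_distrib L.scale_right_diff_distrib)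
  then show "x = L.sc (1/2) (x + J x) + L.sc (1/2) (x - J x)" by simp
qed

lemma fundamental_symmetry_uminus: "fundamental_symmetry L (\<lambda>x. - J x)"
  using L.bop_uminus_fun[OF bop_J] selfadjD[OF selfadj_J]
  by unfold_locales (auto simp: selfadj_def L.cinner_simps J_simps)

lemma mem_clsub_if_bases_subset:
  assumes D: "clsub L D" and "is_onb L Lpos B" "is_onb L Lneg B'" "B \<union> B' \<subseteq> D"
  shows "x \<in> D"
proof -
  have sub: "Lpos \<subseteq> D" "Lneg \<subseteq> D"
    using assms L.cl_span_subset[OF D] unfolding is_onb_def by auto
  obtain p n where "J p = p" "J n = - n" "x = p + n" by (rule Lpos_Lneg_decomposition)
  then show ?thesis using sub L.subspace_add[OF L.clsub_subspace[OF D]] by blast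
qed

end

locale spectral_pair = spectral K G P N R + fundamental_symmetry L J
  for K :: "'a::ab_group_add ips" and G P N R and L :: "'b::ab_group_add ips" and J
begin

lemma spectral_pair_uminus: "spectral_pair K (\<lambda>x. - G x) N P R L (\<lambda>x. - J x)"
  using spectral_uminus fundamental_symmetry_uminus by (rule spectral_pair.intro)

lemma bop_G: "bop K K G"
  by (rule selfadj_bop[OF selfadj_G])

text \<open>A factorization \<open>G = T\<^sup>* J T\<close> with \<open>T\<close> of dense range determines the dimension of the positive
  part of \<open>J\<close>. In one direction, \<open>p \<mapsto> (1 + J) (T p)\<close> is injective on \<open>P\<close> because a kernel vector has a
  nonpositive \<open>G\<close>-form. In the other direction the closure of \<open>T N\<close> is nonpositive and hence meets
  \<open>Lpos\<close> only in \<open>0\<close>, so \<open>Lpos\<close> is projected injectively onto the complement of \<open>T N\<close>; there the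
  density of the range makes \<open>T\<^sup>*\<close>, followed by the projection onto \<open>P\<close>, injective.\<close>

theorem factor_index:
  assumes T: "bop K L T" and fac: "\<And>f g. ip (G f) g = L.ip (J (T f)) (T g)"
    and dense: "\<And>u. (\<And>f. L.ip u (T f) = 0) \<Longrightarrow> u = 0"
    and B: "is_onb K P B" and B': "is_onb L Lpos B'"
  shows "|B'| =o |B|"
proof -
  have "|B| \<le>o |B'|"
  proof (rule onb_card_le[OF hilbert_axioms L.pos_def_space_axioms _ B B'])
    show "bop K L (\<lambda>x. T x + J (T x))"
      by (rule L.bop_add_fun[OF T bop_comp[OF T bop_J]])
    show "T p + J (T p) \<in> Lpos" for p
      by (simp add: J_simps add.commute)
    fix p assume p: "p \<in> P" "T p + J (T p) = 0"
    then have "J (T p) = - T p" by (simp add: eq_neg_iff_add_eq_0 add.commute)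
    then have "Re (ip (G p) p) = - (L.nr (T p))\<^sup>2"
      by (simp add: fac L.cinner_simps L.vnorm_square)
    then show "p = 0" using G_pos[OF p(1)] by (metis neg_0_less_iff_less not_less zero_le_power2)
  qed
  moreover have "|B'| \<le>o |B|"
  proof -
    define F where "F = {u. \<forall>y\<in>T ` N. L.ip u y = 0}"
    have F: "clsub L F" unfolding F_def by (rule L.clsub_orth)
    note bT = bop_adj[OF hilbert_axioms L.pos_def_space_axioms T]
    have adjT: "ip (adj K L T u) x = L.ip u (T x)" for u x
      using cinner_adj[OF hilbert_axioms L.pos_def_space_axioms T, of x u]
      by (metis cinner_hermitian L.cinner_hermitian)
    have T0: "T z = 0" if "G z = 0" for z
    proof -
      have "J (T z) = 0" by (rule dense) (use fac[of z] that in simp)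
      then show ?thesis by (metis J_J bop_zero bop_J)
    qed
    have D: "clsub L (cl L (T ` N))"
    proof (rule L.clsub_cl[OF L.subspaceI])
      note sub = clsub_subspace[OF clsub_N]
      show "0 \<in> T ` N" using bop_zero[OF T] subspace_0[OF sub] by (metis image_eqI)
      show "x + y \<in> T ` N" if "x \<in> T ` N" "y \<in> T ` N" for x y
        using that subspace_add[OF sub] by (auto simp: bop_add[OF T, symmetric])
      show "L.sc c x \<in> T ` N" if "x \<in> T ` N" for c x
        using that subspace_scale[OF sub] by (auto simp: bop_scale[OF T, symmetric])
    qed
    show ?thesis
    proof (rule onb_card_le[OF L.hilbert_axioms pos_def_space_axioms _ B' B])
      show "bop L K (\<lambda>u. proj K P (adj K L T (proj L F u)))"
        by (rule bop_comp[OF bop_comp[OF L.bop_proj[OF F] bT] bop_proj[OF clsub_P]])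
      show "proj K P (adj K L T (proj L F u)) \<in> P" for u
        by (rule proj_mem[OF clsub_P])
      fix u assume u: "u \<in> Lpos" "proj K P (adj K L T (proj L F u)) = 0"
      have "proj L F u = 0"
      proof (rule dense)
        fix f
        obtain p n z where f: "p \<in> P" "n \<in> N" "G z = 0" "f = p + n + z" by (rule decomposition)
        have "L.ip (proj L F u) (T p) = 0"
          using proj_eq_0D[OF clsub_P u(2) f(1)] by (simp add: adjT)
        moreover have "L.ip (proj L F u) (T n) = 0"
          using L.proj_mem[OF F, of u] f(2) by (simp add: F_def)
        ultimately show "L.ip (proj L F u) (T f) = 0"
          by (simp add: f(4) bop_add[OF T] L.cinner_simps T0[OF f(3)])
      qed
      then have orthF: "L.ip u v = 0" if "v \<in> F" for v
        using L.proj_eq_0D[OF F] that by blast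
      let ?d = "proj L (cl L (T ` N)) u"
      have "u - ?d \<in> F"
        using L.proj_orth[OF D] L.subset_cl unfolding F_def by blast
      then have "L.ip u (u - ?d) = 0" by (rule orthF)
      moreover have "L.ip ?d (u - ?d) = 0"
        using L.proj_orth[OF D L.proj_mem[OF D]] L.cinner_eq_0_commute by blast
      ultimately have "L.ip (u - ?d) (u - ?d) = 0" by (simp add: L.cinner_diff_left)
      then have "u = ?d" by (metis L.cinner_self_eq_0D right_minus_eq)
      then have ucl: "u \<in> cl L (T ` N)" using L.proj_mem[OF D] by metis
      show "u = 0"
      proof (rule ccontr)
        assume "u \<noteq> 0"
        then have r: "L.nr u > 0" by (rule L.vnorm_pos)
        \<comment> \<open>The form of \<open>J\<close> is nonpositive on \<open>T N\<close> and equals the square of the norm at \<open>u\<close>. If \<open>u\<close> could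
          be approximated within \<open>e\<close>, then \<open>(nr u)\<^sup>2 \<le> 2 * nr u * e + e\<^sup>2\<close>, which a third of \<open>nr u\<close> violates.\<close>
        define e where "e = L.nr u / 3"
        have "e > 0" using r by (simp add: e_def)
        then obtain n where n: "n \<in> N" "L.nr (u - T n) < e"
          using clD[OF ucl] by blast
        define d where "d = u - T n"
        have Tn: "T n = u - d" by (simp add: d_def)
        have d: "L.nr d < e" using n by (simp add: d_def)
        have Jdu: "L.ip (J d) u = L.ip d u"
          using selfadjD[OF selfadj_J, of d u] u(1) by simp
        have "0 \<ge> Re (L.ip (J (T n)) (T n))"
          using G_form_N[OF n(1)] fac[of n n] by simp
        also have "L.ip (J (T n)) (T n) = L.ip u u - L.ip u d - L.ip d u + L.ip (J d) d"
          using u(1) by (simp add: Tn J_simps L.cinner_simps Jdu)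
        also have "Re \<dots> = (L.nr u)\<^sup>2 - 2 * Re (L.ip u d) + Re (L.ip (J d) d)"
          using L.Re_cinner_commute[of u d] by (simp add: L.vnorm_square)
        finally have "(L.nr u)\<^sup>2 \<le> 2 * Re (L.ip u d) - Re (L.ip (J d) d)" by simp
        also have "\<dots> \<le> 2 * (L.nr u * L.nr d) + L.nr d * L.nr d"
          using L.Cauchy_Schwarz[of u d] L.Cauchy_Schwarz[of "J d" d]
            complex_Re_le_cmod[of "L.ip u d"] abs_Re_le_cmod[of "L.ip (J d) d"]
          by (simp add: vnorm_J)
        also have "\<dots> \<le> 2 * (L.nr u * e) + e * e"
          using d \<open>e > 0\<close> by (intro add_mono mult_mono) auto
        also have "\<dots> = 7/9 * (L.nr u)\<^sup>2"
          by (simp add: e_def power2_eq_square)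
        finally show False using r by simp
      qed
    qed
  qed
  ultimately show ?thesis by (simp add: ordIso_iff_ordLeq)
qed

text \<open>Conversely, bases of equal cardinality yield an isometry \<open>W\<close> of \<open>L\<close> onto the closure of the range
  of \<open>G\<close> that carries \<open>J\<close> to the sign of \<open>G\<close>; then \<open>A = R W\<close> does what is required, where \<open>R\<close> is a
  square root of the modulus of \<open>G\<close>.\<close>

theorem factor_exists:
  assumes "is_onb K P B" "is_onb K N C" "is_onb L Lpos B'" "is_onb L Lneg C'"
    and "|B'| =o |B|" "|C'| =o |C|"
  shows "\<exists>A. bop L K A \<and> (\<forall>f. A (J (adj L K A f)) = G f) \<and> (\<forall>u. A u = 0 \<longrightarrow> u = 0)"
proof -
  have BP: "B \<subseteq> P" and CN: "C \<subseteq> N"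
    using assms(1,2) span_superset subset_cl unfolding is_onb_def by blast+
  have B'L: "B' \<subseteq> Lpos" and C'L: "C' \<subseteq> Lneg"
    using assms(3,4) L.span_superset L.subset_cl unfolding is_onb_def by blast+
  have oB: "orthonormal K B" and oC: "orthonormal K C"
    and oB': "orthonormal L B'" and oC': "orthonormal L C'"
    using assms(1-4) by (simp_all add: is_onb_def)
  have BC: "ip b c = 0" "ip c b = 0" if "b \<in> B" "c \<in> C" for b c
    using that P_orth_N BP CN cinner_eq_0_commute by blast+
  have BC': "L.ip b c = 0" "L.ip c b = 0" if "b \<in> B'" "c \<in> C'" for b c
    using that Lpos_orth_Lneg[of b c] B'L C'L L.cinner_eq_0_commute by blast+
  have disj: "B \<inter> C = {}" using BC orthonormalD[OF oB] by force
  have disj': "B' \<inter> C' = {}" using BC' orthonormalD[OF oB'] by force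
  obtain \<sigma>1 where \<sigma>1: "bij_betw \<sigma>1 B' B" using assms(5) card_of_ordIso by blast
  obtain \<sigma>2 where \<sigma>2: "bij_betw \<sigma>2 C' C" using assms(6) card_of_ordIso by blast
  define \<sigma> where "\<sigma> x = (if x \<in> B' then \<sigma>1 x else \<sigma>2 x)" for x
  have \<sigma>B: "bij_betw \<sigma> B' B"
    using \<sigma>1 by (rule bij_betw_cong[THEN iffD1, rotated]) (simp add: \<sigma>_def)
  have \<sigma>C: "bij_betw \<sigma> C' C"
    using \<sigma>2 by (rule bij_betw_cong[THEN iffD1, rotated]) (use disj' in \<open>auto simp: \<sigma>_def\<close>)
  have \<sigma>: "bij_betw \<sigma> (B' \<union> C') (B \<union> C)" by (rule bij_betw_combine[OF \<sigma>B \<sigma>C disj])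
  have o: "orthonormal K (B \<union> C)"
    using oB oC BC disj unfolding orthonormal_def by auto
  have o': "orthonormal L (B' \<union> C')"
    using oB' oC' BC' disj' unfolding orthonormal_def by auto
  obtain W where bW: "bop L K W" and W: "\<And>b. b \<in> B' \<union> C' \<Longrightarrow> W b = \<sigma> b"
    using bop_extending_orthonormal[OF L.pos_def_space_axioms hilbert_axioms o', of \<sigma>] o \<sigma>
    unfolding bij_betw_def by auto
  define V where "V = adj L K W"
  have bV: "bop K L V"
    unfolding V_def by (rule bop_adj[OF L.hilbert_axioms pos_def_space_axioms bW])
  have WV: "ip (W u) x = L.ip u (V x)" for u x
    unfolding V_def by (rule cinner_adj[OF L.hilbert_axioms pos_def_space_axioms bW])
  note everything = mem_clsub_if_bases_subset[OF _ assms(3,4)]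
  have VW: "V (W u) = u" for u
  proof -
    \<comment> \<open>\<open>W\<close> preserves the inner products of basis vectors; density extends this to all vectors, first in
      one argument and then in the other.\<close>
    have base: "V (W b) = b" if b: "b \<in> B' \<union> C'" for b
    proof -
      have "u \<in> {u. \<forall>z\<in>{V (W b) - b}. L.ip u z = 0}" for u
      proof (rule everything[OF L.clsub_orth])
        have "ip (W c) (W b) = L.ip c b" if c: "c \<in> B' \<union> C'" for c
        proof -
          have "\<sigma> c \<in> B \<union> C" "\<sigma> b \<in> B \<union> C" using \<sigma> b c bij_betwE by blast+
          moreover have "\<sigma> c = \<sigma> b \<longleftrightarrow> c = b"
            using \<sigma> b c unfolding bij_betw_def by (auto dest: inj_onD)
          ultimately show ?thesis
            using orthonormalD[OF o] orthonormalD[OF o' c b] by (simp add: W[OF b] W[OF c])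
        qed
        then show "B' \<union> C' \<subseteq> {u. \<forall>z\<in>{V (W b) - b}. L.ip u z = 0}"
          by (auto simp: L.cinner_diff_right WV[symmetric])
      qed
      then have "L.ip (V (W b) - b) (V (W b) - b) = 0" by blast
      then show ?thesis by (metis L.cinner_self_eq_0D right_minus_eq)
    qed
    have "u \<in> {u. V (W u) = u}"
      by (rule everything[OF L.clsub_equalizer[OF L.pos_def_space_axioms bop_comp[OF bW bV] L.bop_id]])
        (use base in blast)
    then show ?thesis by simp
  qed
  have onB: "\<exists>b\<in>B'. x = W b" if "x \<in> B" for x
    using that \<sigma>B W unfolding bij_betw_def by (metis UnI1 imageE)
  have onC: "\<exists>b\<in>C'. x = W b" if "x \<in> C" for x
    using that \<sigma>C W unfolding bij_betw_def by (metis UnI2 imageE)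
  have WVid: "clsub K {x. W (V x) = x}"
    by (rule clsub_equalizer[OF pos_def_space_axioms bop_comp[OF bV bW] bop_id])
  have onP: "W (V p) = p" "J (V p) = V p" if "p \<in> P" for p
  proof -
    have "P \<subseteq> {x. W (V x) = x}" "P \<subseteq> {x. V x \<in> Lpos}"
      using assms(1) cl_span_subset[OF WVid, of B] onB VW B'L
        cl_span_subset[OF clsub_vimage[OF L.pos_def_space_axioms bV clsub_Lpos], of B]
      unfolding is_onb_def by (fastforce)+
    with that show "W (V p) = p" "J (V p) = V p" by auto
  qed
  have onN: "W (V n) = n" "J (V n) = - V n" if "n \<in> N" for n
  proof -
    have "N \<subseteq> {x. W (V x) = x}" "N \<subseteq> {x. V x \<in> Lneg}"
      using assms(2) cl_span_subset[OF WVid, of C] onC VW C'L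
        cl_span_subset[OF clsub_vimage[OF L.pos_def_space_axioms bV clsub_Lneg], of C]
      unfolding is_onb_def by (fastforce)+
    with that show "W (V n) = n" "J (V n) = - V n" by auto
  qed
  note bR = selfadj_bop[OF selfadj_R]
  define A where "A u = R (W u)" for u
  have bA: "bop L K A" unfolding A_def by (rule bop_comp[OF bW bR])
  have adjA: "adj L K A f = V (R f)" for f
  proof (rule L.eq_if_cinner_eq)
    fix u
    have "L.ip u (adj L K A f) = ip (A u) f"
      by (rule cinner_adj[OF L.hilbert_axioms pos_def_space_axioms bA, symmetric])
    also have "\<dots> = L.ip u (V (R f))" by (simp add: A_def selfadjD[OF selfadj_R] WV)
    finally show "L.ip (adj L K A f) u = L.ip (V (R f)) u" by (metis L.cinner_hermitian)
  qed
  have "A (J (adj L K A f)) = G f" for f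
  proof -
    obtain p n z where f: "p \<in> P" "n \<in> N" "G z = 0" "f = p + n + z" by (rule decomposition)
    have "J (V (R f)) = V (R p) - V (R n)"
      using f R_P(1)[OF f(1)] R_N(1)[OF f(2)] onP(2) onN(2) R_eq_0[of z]
      by (simp add: bop_add[OF bR] bop_add[OF bV] J_simps)
    then have "A (J (adj L K A f)) = R (R p) - R (R n)"
      using onP(1)[OF R_P(1)[OF f(1)]] onN(1)[OF R_N(1)[OF f(2)]]
      by (simp add: adjA A_def bop_diff[OF bW] bop_diff[OF bR])
    also have "\<dots> = G f"
      using R_P(2)[OF f(1)] R_N(2)[OF f(2)] f(3) by (simp add: f(4) bop_add[OF bop_G])
    finally show ?thesis .
  qed
  moreover have "u = 0" if "A u = 0" for u
  proof -
    have G0: "G (W u) = 0" using that R_eq_0 by (simp add: A_def)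
    have "V (W u) = 0"
    proof (rule L.eq_0_if_orthogonal_all)
      fix v
      have "v \<in> {v. W v \<in> {y. \<forall>z\<in>{W u}. ip y z = 0}}"
      proof (rule everything[OF L.clsub_vimage[OF pos_def_space_axioms bW clsub_orth]])
        have "ip (W b) (W u) = 0" if "b \<in> B' \<union> C'" for b
        proof -
          have "W b \<in> P \<union> N" using that W \<sigma>B \<sigma>C bij_betwE BP CN by fastforce
          then show ?thesis using ker_orth[OF G0] cinner_eq_0_commute by blast
        qed
        then show "B' \<union> C' \<subseteq> {v. W v \<in> {y. \<forall>z\<in>{W u}. ip y z = 0}}" by auto
      qed
      then have "ip (W v) (W u) = 0" by simp
      then show "L.ip (V (W u)) v = 0" using WV L.cinner_eq_0_commute by metis
    qed
    then show ?thesis by (simp add: VW)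
  qed
  ultimately show ?thesis using bA by blast
qed

end

section \<open>Krein spaces as Hilbert spaces with a fundamental symmetry\<close>

text \<open>The metric \<open>d\<close> may differ from that of \<open>K\<close> off \<open>S\<close>: on a summand of a fundamental decomposition
  the metric of the Krein space agrees with that of the associated Hilbert space.\<close>

lemma (in pos_def_space) complete_subset_limit:
  fixes \<sigma> :: "nat \<Rightarrow> 'a"
  assumes mc: "Metric_space.mcomplete S d"
    and d: "\<And>x y. x \<in> S \<Longrightarrow> y \<in> S \<Longrightarrow> d x y = nr (x - y)" "\<And>x y. 0 \<le> d x y" "\<And>x y. d x y = d y x"
    and \<sigma>: "\<And>i. \<sigma> i \<in> S" "\<And>e. e > 0 \<Longrightarrow> \<exists>n. \<forall>i\<ge>n. \<forall>j\<ge>n. nr (\<sigma> i - \<sigma> j) < e"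
  shows "\<exists>x\<in>S. \<forall>e>0. \<exists>n. \<forall>i\<ge>n. nr (\<sigma> i - x) < e"
proof -
  interpret M: Metric_space S d
    using d(1) by unfold_locales (auto simp: d(2) d(3) vnorm_triangle_diff)
  have "M.MCauchy \<sigma>"
    unfolding M.MCauchy_def using \<sigma> by (auto simp: d(1))
  then obtain x where "limitin M.mtopology \<sigma> x sequentially"
    using mc M.mcomplete_def by blast
  then have x: "x \<in> S" "\<forall>e>0. \<exists>n. \<forall>i\<ge>n. \<sigma> i \<in> S \<and> d (\<sigma> i) x < e"
    unfolding M.limit_metric_sequentially by auto
  then show ?thesis by (metis d(1))
qed

locale decomposed_space = inner_product_space H for H :: "'a::ab_group_add ips" +
  fixes P N
  assumes decomposition: "fundamental_decomposition H P N"
begin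

abbreviation "K \<equiv> associated_hilbert H P N"
abbreviation "pc \<equiv> component P N"
abbreviation "nc \<equiv> component N P"

lemma subspace_P: "subspace P" and subspace_N: "subspace N"
  using decomposition
  by (simp_all add: fundamental_decomposition_def hilbert_subspace_def antispace_def)

lemma P_orth_N: "p \<in> P \<Longrightarrow> n \<in> N \<Longrightarrow> cinner H p n = 0"
  and N_orth_P: "p \<in> P \<Longrightarrow> n \<in> N \<Longrightarrow> cinner H n p = 0"
  using decomposition cinner_eq_0_commute unfolding fundamental_decomposition_def by blast+

lemma P_positive: "p \<in> P \<Longrightarrow> p \<noteq> 0 \<Longrightarrow> 0 < Re (cinner H p p)"
  and N_negative: "n \<in> N \<Longrightarrow> n \<noteq> 0 \<Longrightarrow> Re (cinner H n n) < 0"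
  using decomposition
  by (auto simp: fundamental_decomposition_def hilbert_subspace_def antispace_def)

text \<open>Two decompositions of one vector differ by an element of \<open>P \<inter> N = {0}\<close>, so that the definite
  descriptions in \<^const>\<open>component\<close> denote.\<close>

lemma components:
  shows pc_mem: "pc x \<in> P" and nc_mem: "nc x \<in> N" and pc_nc: "pc x + nc x = x"
    and components_unique: "p \<in> P \<Longrightarrow> n \<in> N \<Longrightarrow> pc (p + n) = p" "p \<in> P \<Longrightarrow> n \<in> N \<Longrightarrow> nc (p + n) = n"
proof -
  have unique: "p = p' \<and> n = n'" if "p \<in> P" "p' \<in> P" "n \<in> N" "n' \<in> N" "p + n = p' + n'" for p p' n n'
  proof -
    have eq: "p - p' = n' - n" using that(5) by (metis add_diff_cancel_left' add_diff_eq diff_add_eq diff_diff_eq2 add.commute)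
    have "p - p' \<in> P" "p - p' \<in> N"
      using subspace_diff[OF subspace_P that(1,2)] subspace_diff[OF subspace_N that(4,3)] eq by simp_all
    then have "p - p' = 0" using decomposition unfolding fundamental_decomposition_def by blast
    then show ?thesis using eq by simp
  qed
  show *: "pc (p + n) = p" "nc (p + n) = n" if "p \<in> P" "n \<in> N" for p n
  proof -
    show "pc (p + n) = p"
      unfolding component_def
    proof (rule the_equality)
      fix q assume "q \<in> P \<and> p + n - q \<in> N"
      moreover have "q + (p + n - q) = p + n" by simp
      ultimately show "q = p" using unique[of q p "p + n - q" n] that by blast
    qed (use that in simp)
    show "nc (p + n) = n"
      unfolding component_def
    proof (rule the_equality)
      fix q assume "q \<in> N \<and> p + n - q \<in> P"
      moreover have "(p + n - q) + q = p + n" by simp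
      ultimately show "q = n" using unique[of "p + n - q" p q n] that by blast
    qed (use that in simp)
  qed
  obtain p n where "p \<in> P" "n \<in> N" "x = p + n"
    using decomposition unfolding fundamental_decomposition_def by blast
  then show "pc x \<in> P" "nc x \<in> N" "pc x + nc x = x" using * by simp_all
qed

lemma pc_add: "pc (x + y) = pc x + pc y" and nc_add: "nc (x + y) = nc x + nc y"
proof -
  have eq: "x + y = (pc x + pc y) + (nc x + nc y)"
    by (metis pc_nc add.assoc add.left_commute)
  have mem: "pc x + pc y \<in> P" "nc x + nc y \<in> N"
    using pc_mem nc_mem subspace_add subspace_P subspace_N by blast+
  show "pc (x + y) = pc x + pc y" "nc (x + y) = nc x + nc y"
    using components_unique[OF mem] eq by simp_all
qed

lemma pc_scale: "pc (cscale H a x) = cscale H a (pc x)"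
  and nc_scale: "nc (cscale H a x) = cscale H a (nc x)"
proof -
  have eq: "cscale H a x = cscale H a (pc x) + cscale H a (nc x)"
    by (metis pc_nc scale_right_distrib)
  have mem: "cscale H a (pc x) \<in> P" "cscale H a (nc x) \<in> N"
    using pc_mem nc_mem subspace_scale subspace_P subspace_N by blast+
  show "pc (cscale H a x) = cscale H a (pc x)" "nc (cscale H a x) = cscale H a (nc x)"
    using components_unique[OF mem] eq by simp_all
qed

lemma pc_P: "x \<in> P \<Longrightarrow> pc x = x" and nc_P: "x \<in> P \<Longrightarrow> nc x = 0"
  and pc_N: "x \<in> N \<Longrightarrow> pc x = 0" and nc_N: "x \<in> N \<Longrightarrow> nc x = x"
  using components_unique[of x 0] components_unique[of 0 x]
    subspace_0[OF subspace_P] subspace_0[OF subspace_N] by simp_all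

lemma cscale_K [simp]: "cscale K = cscale H"
  by (simp add: associated_hilbert_def)

lemma cinner_K: "cinner K x y = cinner H (pc x) (pc y) - cinner H (nc x) (nc y)"
  by (simp add: associated_hilbert_def)

definition "J x = pc x - nc x"

lemma pos_def_space_K: "pos_def_space K"
proof (intro pos_def_space.intro inner_product_space.intro)
  show "vector_space (cscale K)" by (simp add: vector_space_axioms)
  show "inner_product_space_axioms K"
  proof
    fix x y z a
    show "cinner K (x + y) z = cinner K x z + cinner K y z"
      by (simp add: cinner_K pc_add nc_add cinner_simps)
    show "cinner K (cscale K a x) y = a * cinner K x y"
      by (simp add: cinner_K pc_scale nc_scale cinner_simps right_diff_distrib)
    show "cinner K y x = cnj (cinner K x y)"
      by (simp add: cinner_K cinner_hermitian[symmetric])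
  qed
  show "pos_def_space_axioms K"
  proof
    fix x :: 'a assume "x \<noteq> 0"
    then have "pc x \<noteq> 0 \<or> nc x \<noteq> 0" using pc_nc[of x] by auto
    moreover have "0 \<le> Re (cinner H (pc x) (pc x))"
      using P_positive[OF pc_mem, of x] by (cases "pc x = 0") auto
    moreover have "Re (cinner H (nc x) (nc x)) \<le> 0"
      using N_negative[OF nc_mem, of x] by (cases "nc x = 0") auto
    ultimately show "0 < Re (cinner K x x)"
      using P_positive[OF pc_mem, of x] N_negative[OF nc_mem, of x] by (fastforce simp: cinner_K)
  qed
qed

lemma hilbert_K: "hilbert K"
proof (intro hilbert.intro hilbert_axioms.intro pos_def_space_K)
  interpret K: pos_def_space K by (rule pos_def_space_K)
  interpret M: Metric_space UNIV "cdist K" by (rule K.Metric_space_cdist)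
  have pn: "(vnorm K x)\<^sup>2 = (vnorm K (pc x))\<^sup>2 + (vnorm K (nc x))\<^sup>2" for x
    unfolding K.vnorm_square cinner_K by (simp add: pc_mem nc_mem pc_P nc_P pc_N nc_N)
  have le: "vnorm K (pc x) \<le> vnorm K x" "vnorm K (nc x) \<le> vnorm K x" for x
    by (rule power2_le_imp_le, simp add: pn[of x], simp)+
  have comm: "cinner H (x - y) (x - y) = cinner H (y - x) (y - x)" for x y
    by (metis cinner_minus_left cinner_minus_right minus_diff_eq minus_minus)
  have dP: "cdist H x y = vnorm K (x - y)" if "x \<in> P" "y \<in> P" for x y
    unfolding K.cdist_vnorm[symmetric]
    using subspace_diff[OF subspace_P that] by (simp add: cdist_def cinner_K pc_P nc_P)
  have dN: "cdist (antispace H) x y = vnorm K (x - y)" if "x \<in> N" "y \<in> N" for x y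
    unfolding K.cdist_vnorm[symmetric]
    using subspace_diff[OF subspace_N that] by (simp add: cdist_def cinner_K pc_N nc_N antispace_def)
  show "M.mcomplete"
    unfolding M.mcomplete_def
  proof (intro allI impI)
    fix \<sigma> :: "nat \<Rightarrow> 'a" assume "M.MCauchy \<sigma>"
    then have "\<forall>e>0. \<exists>n. \<forall>i j. n \<le> i \<longrightarrow> n \<le> j \<longrightarrow> vnorm K (\<sigma> i - \<sigma> j) < e"
      by (simp add: M.MCauchy_def K.cdist_vnorm)
    then have C: "\<exists>n. \<forall>i\<ge>n. \<forall>j\<ge>n. vnorm K (\<sigma> i - \<sigma> j) < e" if "e > 0" for e
      using that by meson
    have pd: "pc (\<sigma> i) - pc (\<sigma> j) = pc (\<sigma> i - \<sigma> j)" "nc (\<sigma> i) - nc (\<sigma> j) = nc (\<sigma> i - \<sigma> j)" for i j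
      using pc_add[of "\<sigma> i - \<sigma> j" "\<sigma> j"] nc_add[of "\<sigma> i - \<sigma> j" "\<sigma> j"] by simp_all
    have "\<exists>x\<in>P. \<forall>e>0. \<exists>n. \<forall>i\<ge>n. vnorm K (pc (\<sigma> i) - x) < e"
    proof (rule K.complete_subset_limit[where d = "cdist H"])
      show "Metric_space.mcomplete P (cdist H)"
        using decomposition by (simp add: fundamental_decomposition_def hilbert_subspace_def)
      show "\<exists>n. \<forall>i\<ge>n. \<forall>j\<ge>n. vnorm K (pc (\<sigma> i) - pc (\<sigma> j)) < e" if "e > 0" for e
        unfolding pd using C[OF that] le(1) by (meson order_le_less_trans)
    qed (use dP pc_mem comm in \<open>auto simp: cdist_def\<close>)
    then obtain p where p: "\<And>e. e > 0 \<Longrightarrow> \<exists>n. \<forall>i\<ge>n. vnorm K (pc (\<sigma> i) - p) < e" by blast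
    have "\<exists>x\<in>N. \<forall>e>0. \<exists>n. \<forall>i\<ge>n. vnorm K (nc (\<sigma> i) - x) < e"
    proof (rule K.complete_subset_limit[where d = "cdist (antispace H)"])
      show "Metric_space.mcomplete N (cdist (antispace H))"
        using decomposition by (simp add: fundamental_decomposition_def hilbert_subspace_def)
      show "\<exists>n. \<forall>i\<ge>n. \<forall>j\<ge>n. vnorm K (nc (\<sigma> i) - nc (\<sigma> j)) < e" if "e > 0" for e
        unfolding pd using C[OF that] le(2) by (meson order_le_less_trans)
    qed (use dN nc_mem comm in \<open>auto simp: cdist_def antispace_def\<close>)
    then obtain n where n: "\<And>e. e > 0 \<Longrightarrow> \<exists>k. \<forall>i\<ge>k. vnorm K (nc (\<sigma> i) - n) < e" by blast
    have "\<exists>k. \<forall>i\<ge>k. vnorm K (\<sigma> i - (p + n)) < e" if "e > 0" for e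
    proof -
      have "e/2 > 0" using that by simp
      then obtain k1 k2 where k: "\<forall>i\<ge>k1. vnorm K (pc (\<sigma> i) - p) < e/2" "\<forall>i\<ge>k2. vnorm K (nc (\<sigma> i) - n) < e/2"
        using p n by meson
      have "vnorm K (\<sigma> i - (p + n)) < e" if "i \<ge> max k1 k2" for i
      proof -
        have "\<sigma> i - (p + n) = (pc (\<sigma> i) - p) + (nc (\<sigma> i) - n)"
          using pc_nc[of "\<sigma> i"] by (metis add_diff_add)
        then have "vnorm K (\<sigma> i - (p + n)) = vnorm K ((pc (\<sigma> i) - p) + (nc (\<sigma> i) - n))"
          by (rule arg_cong)
        moreover have "vnorm K (pc (\<sigma> i) - p) < e/2" "vnorm K (nc (\<sigma> i) - n) < e/2"
          using k that by simp_all
        ultimately show ?thesis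
          using K.vnorm_triangle[of "pc (\<sigma> i) - p" "nc (\<sigma> i) - n"] by linarith
      qed
      then show ?thesis by blast
    qed
    then show "\<exists>x. limitin M.mtopology \<sigma> x sequentially"
      unfolding M.limit_metric_sequentially K.cdist_vnorm by auto
  qed
qed

lemma pc_J: "pc (J x) = pc x" and nc_J: "nc (J x) = - nc x"
proof -
  have m: "- nc x \<in> N" using nc_mem subspace_neg[OF subspace_N] by blast
  have "J x = pc x + - nc x" by (simp add: J_def)
  then show "pc (J x) = pc x" "nc (J x) = - nc x"
    using components_unique[OF pc_mem m] by simp_all
qed

lemma cinner_J_left: "cinner K (J x) y = cinner H x y"
proof -
  have "cinner H x y = cinner H (pc x + nc x) (pc y + nc y)" by (simp add: pc_nc)
  also have "\<dots> = cinner H (pc x) (pc y) + cinner H (nc x) (nc y)"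
    by (simp add: cinner_simps P_orth_N N_orth_P pc_mem nc_mem)
  finally show ?thesis by (simp add: cinner_K pc_J nc_J cinner_simps)
qed

lemma fundamental_symmetry_K: "fundamental_symmetry K J"
proof (intro fundamental_symmetry.intro hilbert_K fundamental_symmetry_axioms.intro)
  interpret K: hilbert K by (rule hilbert_K)
  show JJ: "J (J x) = x" for x
    using pc_nc[of x] by (simp add: J_def[of "J x"] pc_J nc_J)
  have adj: "cinner K (J x) y = cinner K x (J y)" for x y
    by (simp add: cinner_K pc_J nc_J cinner_simps)
  have "vnorm K (J x) = vnorm K x" for x
    by (simp add: vnorm_def adj JJ)
  then have "bop K K J"
    unfolding bop_def
    by (auto simp: J_def pc_add nc_add pc_scale nc_scale scale_right_diff_distrib intro!: exI[of _ 1])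
  with adj show "selfadj K J" by (simp add: selfadj_def)
qed

lemma Lpos_eq: "{x. J x = x} = P"
proof -
  have "x \<in> P" if "J x = x" for x
  proof -
    have "- nc x = nc x" using nc_J[of x] that by simp
    then have "cinner H (nc x) (nc x) = 0" using cinner_minus_left[of "nc x" "nc x"] by simp
    then have "nc x = 0" using N_negative[OF nc_mem, of x] by auto
    then show ?thesis using pc_nc[of x] pc_mem[of x] by simp
  qed
  moreover have "J x = x" if "x \<in> P" for x
    using that by (simp add: J_def pc_P nc_P)
  ultimately show ?thesis by blast
qed

lemma Lneg_eq: "{x. J x = - x} = N"
proof -
  have "x \<in> N" if "J x = - x" for x
  proof -
    have "pc (- x) = - pc x" using pc_add[of x "- x"] pc_P[OF subspace_0[OF subspace_P]]
      by (simp add: eq_neg_iff_add_eq_0 add.commute)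
    then have "- pc x = pc x" using pc_J[of x] that by simp
    then have "cinner H (pc x) (pc x) = 0" using cinner_minus_left[of "pc x" "pc x"] by simp
    then have "pc x = 0" using P_positive[OF pc_mem, of x] by auto
    then show ?thesis using pc_nc[of x] nc_mem[of x] by simp
  qed
  moreover have "J x = - x" if "x \<in> N" for x
    using that by (simp add: J_def pc_N nc_N)
  ultimately show ?thesis by blast
qed

end

locale krein =
  fixes H :: "'a::ab_group_add ips"
  assumes krein: "krein_space H"
begin

lemma decomposed: "decomposed_space H (pos_part H) (neg_part H)"
proof -
  have "\<exists>PN. case PN of (P, N) \<Rightarrow> fundamental_decomposition H P N"
    using krein unfolding krein_space_def by auto
  from someI_ex[OF this] have "fundamental_decomposition H (pos_part H) (neg_part H)"
    unfolding pos_part_def neg_part_def by (auto split: prod.splits)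
  then show ?thesis
    using krein by (simp add: krein_space_def decomposed_space_def decomposed_space_axioms_def)
qed

sublocale D: decomposed_space H "pos_part H" "neg_part H"
  rewrites "associated_hilbert H (pos_part H) (neg_part H) \<equiv> abs_space H"
  using decomposed by (simp_all add: abs_space_def)

abbreviation "J \<equiv> D.J"

sublocale fundamental_symmetry "abs_space H" J
  by (rule D.fundamental_symmetry_K)

lemma cscale_abs [simp]: "cscale (abs_space H) = cscale H"
  by (rule D.cscale_K)

lemma cinner_J: "cinner (abs_space H) (J x) y = cinner H x y"
  by (rule D.cinner_J_left)

lemma cinner_J_right: "cinner (abs_space H) x (J y) = cinner H x y"
  using cinner_J[of x y] selfadjD[OF selfadj_J, of x y] by simp

lemma nondegenerate: "(\<And>y. cinner H y x = cinner H y z) \<Longrightarrow> x = z"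
  by (metis L.eq_if_cinner_eq D.cinner_J_left J_J cinner_J_right L.cinner_hermitian)

lemma strong_topology_closure: "strong_topology H closure_of S = cl (abs_space H) S"
proof -
  interpret M: Metric_space UNIV "cdist (abs_space H)" by (rule L.Metric_space_cdist)
  show ?thesis
    unfolding strong_topology_def M.metric_closure_of cl_def by (simp add: L.cdist_vnorm)
qed

lemma closed_subspace_iff: "closed_subspace H M \<longleftrightarrow> clsub (abs_space H) M"
proof -
  have "topspace (strong_topology H) = UNIV"
    unfolding strong_topology_def
    by (simp add: Metric_space.topspace_mtopology[OF L.Metric_space_cdist])
  then have "closedin (strong_topology H) M \<longleftrightarrow> cl (abs_space H) M \<subseteq> M"
    unfolding strong_topology_closure[symmetric]
    by (metis closure_of_subset_eq subset_UNIV)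
  then show ?thesis by (simp add: closed_subspace_def clsub_def)
qed

lemma orthonormal_basis_iff: "orthonormal_basis H M B \<longleftrightarrow> is_onb (abs_space H) M B"
  by (simp add: orthonormal_basis_def is_onb_def orthonormal_def strong_topology_closure)

lemma hilbert_dim_onb:
  assumes "clsub (abs_space H) M"
  obtains B where "is_onb (abs_space H) M B" "hilbert_dim H M = |B|"
proof
  show "is_onb (abs_space H) M (SOME B. orthonormal_basis H M B)"
    using someI_ex[OF L.onb_exists[OF assms]] by (simp add: orthonormal_basis_iff)
  show "hilbert_dim H M = |SOME B. orthonormal_basis H M B|"
    by (simp add: hilbert_dim_def)
qed

end

text \<open>Continuity at \<open>0\<close> bounds \<open>T\<close> on a small ball, and homogeneity spreads the bound.\<close>

lemma bounded_ops_iff: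
  assumes "krein_space H" "krein_space H'"
  shows "T \<in> bounded_ops H H' \<longleftrightarrow> bop (abs_space H) (abs_space H') T"
proof -
  interpret A: krein H by unfold_locales fact
  interpret B: krein H' by unfold_locales fact
  let ?n = "vnorm (abs_space H)" and ?n' = "vnorm (abs_space H')"
  interpret M: Metric_space UNIV "cdist (abs_space H)" by (rule A.L.Metric_space_cdist)
  interpret M': Metric_space UNIV "cdist (abs_space H')" by (rule B.L.Metric_space_cdist)
  have cont: "continuous_map (strong_topology H) (strong_topology H') T \<longleftrightarrow>
      (\<forall>a. \<forall>e>0. \<exists>d>0. \<forall>x. ?n (a - x) < d \<longrightarrow> ?n' (T a - T x) < e)"
    unfolding strong_topology_def M.metric_continuous_map[OF M'.Metric_space_axioms]
    by (simp add: A.L.cdist_vnorm B.L.cdist_vnorm)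
  have lin: "Vector_Spaces.linear (cscale H) (cscale H') T \<longleftrightarrow>
      (\<forall>x y. T (x + y) = T x + T y) \<and> (\<forall>a x. T (cscale H a x) = cscale H' a (T x))"
    using A.D.vector_space_axioms B.D.vector_space_axioms by (simp add: Vector_Spaces.linear_iff)
  show ?thesis
  proof
    assume T: "T \<in> bounded_ops H H'"
    then have add: "T (x + y) = T x + T y" and scale: "T (cscale H a x) = cscale H' a (T x)" for x y a
      using lin by (simp_all add: bounded_ops_def)
    have T0: "T 0 = 0" using add[of 0 0] by simp
    have "\<forall>a. \<forall>e>0. \<exists>d>0. \<forall>x. ?n (a - x) < d \<longrightarrow> ?n' (T a - T x) < e"
      using T cont by (simp add: bounded_ops_def)
    then obtain d where d: "d > 0" "\<And>x. ?n (0 - x) < d \<Longrightarrow> ?n' (T 0 - T x) < 1"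
      by (meson zero_less_one)
    have "?n' (T x) \<le> (2 / d) * ?n x" for x
    proof (cases "x = 0")
      case False
      then have n: "?n x > 0" by (rule A.L.vnorm_pos)
      define a where "a = complex_of_real (d / (2 * ?n x))"
      have a: "cmod a = d / (2 * ?n x)" using d n by (simp add: a_def norm_divide norm_mult)
      have "?n (cscale H a x) = d / 2"
        using A.L.vnorm_scale[of a x] a False by simp
      then have "?n' (T (cscale H a x)) < 1"
        using d(2)[of "cscale H a x"] d(1) by (simp add: T0)
      then have "cmod a * ?n' (T x) < 1"
        using B.L.vnorm_scale[of a "T x"] by (simp add: scale)
      then show ?thesis using n d(1) unfolding a by (simp add: field_simps)
    qed (simp add: T0)
    then show "bop (abs_space H) (abs_space H') T"
      unfolding bop_def using add scale d(1) by (auto intro!: exI[of _ "2/d"])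
  next
    assume T: "bop (abs_space H) (abs_space H') T"
    obtain c where c: "c > 0" "\<And>x. ?n' (T x) \<le> c * ?n x" using A.L.bop_bound[OF T] by metis
    have "\<exists>d>0. \<forall>x. ?n (a - x) < d \<longrightarrow> ?n' (T a - T x) < e" if "e > 0" for a e
    proof (intro exI[of _ "e / c"] conjI allI impI)
      fix x assume "?n (a - x) < e / c"
      then have "c * ?n (a - x) < e" using c(1) by (simp add: pos_less_divide_eq mult.commute)
      then show "?n' (T a - T x) < e" using c(2)[of "a - x"] by (simp add: bop_diff[OF T])
    qed (use that c in simp)
    then show "T \<in> bounded_ops H H'"
      unfolding bounded_ops_def mem_Collect_eq cont lin
      using bop_add[OF T] bop_scale[OF T] by simp
  qed
qed

text \<open>The adjoint between the associated Hilbert spaces, conjugated with the fundamental symmetries,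
  exists and has the defining property; nondegeneracy leaves no other candidate.\<close>

lemma krein_adjoint:
  assumes "krein_space H" "krein_space H'" "T \<in> bounded_ops H H'"
  shows krein_adjoint_bounded: "krein_adjoint H H' T \<in> bounded_ops H' H"
    and cinner_krein_adjoint: "cinner H' (T f) g = cinner H f (krein_adjoint H H' T g)"
proof -
  interpret A: krein H by unfold_locales fact
  interpret B: krein H' by unfold_locales fact
  have T: "bop (abs_space H) (abs_space H') T" using assms bounded_ops_iff by blast
  let ?P = "\<lambda>S. S \<in> bounded_ops H' H \<and> (\<forall>f g. cinner H' (T f) g = cinner H f (S g))"
  define S where "S g = A.J (adj (abs_space H) (abs_space H') T (B.J g))" for g
  have "bop (abs_space H') (abs_space H) S"
    unfolding S_def
    by (rule bop_comp[OF bop_comp[OF B.bop_J bop_adj[OF A.L.hilbert_axioms B.L.pos_def_space_axioms T]] A.bop_J])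
  then have "S \<in> bounded_ops H' H" using assms bounded_ops_iff by blast
  moreover have "cinner H' (T f) g = cinner H f (S g)" for f g
    by (simp add: S_def A.cinner_J_right[symmetric] B.cinner_J_right[symmetric]
        cinner_adj[OF A.L.hilbert_axioms B.L.pos_def_space_axioms T])
  ultimately have S: "?P S" by blast
  have "?P (krein_adjoint H H' T)"
    unfolding krein_adjoint_def
  proof (rule theI[where P = ?P, OF S])
    show "S' = S" if "?P S'" for S'
      using that S by (intro ext A.nondegenerate) metis
  qed
  then show "krein_adjoint H H' T \<in> bounded_ops H' H"
    and "cinner H' (T f) g = cinner H f (krein_adjoint H H' T g)" by blast+
qed

lemma krein_adjoint_eq:
  assumes "krein_space H" "krein_space H'" "bop (abs_space H) (abs_space H') T"
  shows "krein_adjoint H H' T g = krein.J H (adj (abs_space H) (abs_space H') T (krein.J H' g))"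
proof -
  interpret A: krein H by unfold_locales fact
  interpret B: krein H' by unfold_locales fact
  have T: "T \<in> bounded_ops H H'" using assms bounded_ops_iff by blast
  show ?thesis
  proof (rule A.nondegenerate)
    fix f
    let ?S = "adj (abs_space H) (abs_space H') T"
    have "cinner H f (krein_adjoint H H' T g) = cinner H' (T f) g"
      by (rule cinner_krein_adjoint[OF assms(1,2) T, symmetric])
    also have "\<dots> = cinner (abs_space H') (T f) (B.J g)" by (simp add: B.cinner_J_right)
    also have "\<dots> = cinner (abs_space H) f (?S (B.J g))"
      by (rule cinner_adj[OF A.L.hilbert_axioms B.L.pos_def_space_axioms assms(3)])
    also have "\<dots> = cinner H f (A.J (?S (B.J g)))" by (simp add: A.cinner_J_right[symmetric])
    finally show "cinner H f (krein_adjoint H H' T g) = cinner H f (A.J (?S (B.J g)))" .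
  qed
qed

section \<open>Hermitian indices and the factorization theorem\<close>

context krein
begin

lemma max_hilbert_dim_eq:
  assumes "Q M" and max: "\<And>M'. Q M' \<Longrightarrow> hilbert_dim H M' \<le>o hilbert_dim H M"
  shows "max_hilbert_dim H Q =o hilbert_dim H M"
proof -
  let ?M = "SOME M. Q M \<and> (\<forall>M'. Q M' \<longrightarrow> hilbert_dim H M' \<le>o hilbert_dim H M)"
  have "Q ?M \<and> (\<forall>M'. Q M' \<longrightarrow> hilbert_dim H M' \<le>o hilbert_dim H ?M)"
    by (rule someI_ex) (use assms in blast)
  then show ?thesis
    unfolding max_hilbert_dim_def ordIso_iff_ordLeq using assms by blast
qed

text \<open>The subspace \<open>P\<close> is itself closed and strictly positive, and it dominates every other such subspace
  by projection. Any maximizing subspace therefore has the same dimension as \<open>P\<close>.\<close>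

lemma max_strictly_positive_dim:
  assumes "spectral (abs_space H) G P N R" and B: "is_onb (abs_space H) P B"
  shows "max_hilbert_dim H (\<lambda>M. closed_subspace H M \<and>
    (\<forall>x\<in>M. x \<noteq> 0 \<longrightarrow> 0 < Re (cinner (abs_space H) (G x) x))) =o |B|" (is "max_hilbert_dim H ?Q =o |B|")
proof -
  interpret S: spectral "abs_space H" G P N R by fact
  obtain B' where B': "is_onb (abs_space H) P B'" "hilbert_dim H P = |B'|"
    using hilbert_dim_onb[OF S.clsub_P] by blast
  have "max_hilbert_dim H ?Q =o hilbert_dim H P"
  proof (rule max_hilbert_dim_eq)
    show "?Q P" using S.clsub_P S.G_pos by (simp add: closed_subspace_iff)
    fix M assume M: "?Q M"
    then obtain E where "is_onb (abs_space H) M E" "hilbert_dim H M = |E|"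
      using hilbert_dim_onb closed_subspace_iff by blast
    then show "hilbert_dim H M \<le>o hilbert_dim H P"
      using S.strictly_positive_card_le[of M E B'] M B' by simp
  qed
  moreover have "|B'| =o |B|"
    using S.strictly_positive_card_le[OF B'(1) S.G_pos B]
      S.strictly_positive_card_le[OF B S.G_pos B'(1)] by (simp add: ordIso_iff_ordLeq)
  ultimately show ?thesis unfolding B'(2) by (rule ordIso_transitive)
qed

lemma herm_index_pos_eq:
  assumes "spectral (abs_space H) (\<lambda>x. J (C x)) P N R" "is_onb (abs_space H) P B"
  shows "herm_index_pos H C =o |B|"
  using max_strictly_positive_dim[OF assms]
  by (simp add: herm_index_pos_def strictly_positive_def op_inner_def cinner_J)

lemma herm_index_neg_eq:
  assumes "spectral (abs_space H) (\<lambda>x. J (C x)) P N R" "is_onb (abs_space H) N B"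
  shows "herm_index_neg H C =o |B|"
  using max_strictly_positive_dim[OF spectral.spectral_uminus[OF assms(1)] assms(2)]
  by (simp add: herm_index_neg_def strictly_negative_def op_inner_def L.cinner_minus_left cinner_J)

lemma selfadjoint_selfadj:
  assumes "C \<in> bounded_ops H H" "selfadjoint H C"
  shows "selfadj (abs_space H) (\<lambda>x. J (C x))"
  unfolding selfadj_def
proof (intro conjI allI)
  show "bop (abs_space H) (abs_space H) (\<lambda>x. J (C x))"
    using assms(1) bounded_ops_iff[OF krein krein] bop_comp bop_J by blast
  have "cinner H (C x) y = cinner H x (C y)" for x y
    using cinner_krein_adjoint[OF krein krein assms(1)] assms(2) by (simp add: selfadjoint_def)
  then show "cinner (abs_space H) (J (C x)) y = cinner (abs_space H) x (J (C y))" for x y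
    by (simp add: cinner_J cinner_J_right)
qed

end

theorem theorem3p1:
  fixes \<H> :: "'h::ab_group_add ips" and \<A> :: "'a::ab_group_add ips" and C :: "'h \<Rightarrow> 'h"
  assumes "krein_space \<H>"
    and "C \<in> bounded_ops \<H> \<H>" and "selfadjoint \<H> C"
    and "krein_space \<A>"
  shows "(\<exists>A \<in> bounded_ops \<A> \<H>. C = A \<circ> krein_adjoint \<A> \<H> A \<and> {x. A x = 0} = {0}) \<longleftrightarrow>
    ind_pos \<A> =o herm_index_pos \<H> C \<and> ind_neg \<A> =o herm_index_neg \<H> C"
proof -
  interpret H: krein \<H> by unfold_locales fact
  interpret A: krein \<A> by unfold_locales fact
  let ?K = "abs_space \<H>" and ?L = "abs_space \<A>"
  define G where "G x = H.J (C x)" for x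
  have G: "selfadj ?K G"
    unfolding G_def using assms(2,3) by (rule H.selfadjoint_selfadj)
  obtain P N R where split: "spectral_split ?K G P N R"
    using H.L.spectral_split_exists[OF G] by blast
  interpret S: spectral_pair ?K G P N R ?L A.J
    by unfold_locales (use split G in auto)
  obtain B B' where B: "is_onb ?K P B" and B': "is_onb ?K N B'"
    using H.L.onb_exists[OF S.clsub_P] H.L.onb_exists[OF S.clsub_N] by blast
  have pos_part: "A.Lpos = pos_part \<A>" and neg_part: "A.Lneg = neg_part \<A>"
    by (rule A.D.Lpos_eq A.D.Lneg_eq)+
  obtain E where E: "is_onb ?L A.Lpos E" "ind_pos \<A> = |E|"
    using A.hilbert_dim_onb[OF A.clsub_Lpos] unfolding pos_part ind_pos_def by blast
  obtain E' where E': "is_onb ?L A.Lneg E'" "ind_neg \<A> = |E'|"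
    using A.hilbert_dim_onb[OF A.clsub_Lneg] unfolding neg_part ind_neg_def by blast
  have pos: "herm_index_pos \<H> C =o |B|" and neg: "herm_index_neg \<H> C =o |B'|"
    using H.herm_index_pos_eq H.herm_index_neg_eq S.spectral_axioms B B' unfolding G_def by blast+
  have "(\<exists>A \<in> bounded_ops \<A> \<H>. C = A \<circ> krein_adjoint \<A> \<H> A \<and> {x. A x = 0} = {0}) \<longleftrightarrow>
      |E| =o |B| \<and> |E'| =o |B'|"
  proof
    assume "\<exists>A \<in> bounded_ops \<A> \<H>. C = A \<circ> krein_adjoint \<A> \<H> A \<and> {x. A x = 0} = {0}"
    then obtain A where A: "A \<in> bounded_ops \<A> \<H>" "C = A \<circ> krein_adjoint \<A> \<H> A" "{x. A x = 0} = {0}"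
      by blast
    let ?T = "krein_adjoint \<A> \<H> A"
    have T: "bop ?K ?L ?T"
      using krein_adjoint_bounded[OF assms(4,1) A(1)] bounded_ops_iff assms by blast
    have adj: "cinner \<H> (A u) f = cinner \<A> u (?T f)" for u f
      by (rule cinner_krein_adjoint[OF assms(4,1) A(1)])
    have fac: "cinner ?K (G f) g = cinner ?L (A.J (?T f)) (?T g)" for f g
    proof -
      have "cinner ?K (G f) g = cinner \<H> (A (?T f)) g"
        unfolding G_def H.cinner_J using A(2) by (metis comp_apply)
      then show ?thesis by (simp add: adj A.cinner_J)
    qed
    have dense: "u = 0" if u: "\<And>f. cinner ?L u (?T f) = 0" for u
    proof -
      have "A (A.J u) = 0"
      proof (rule H.L.eq_0_if_orthogonal_all)
        fix y
        have "cinner ?K (A (A.J u)) y = cinner \<H> (A (A.J u)) (H.J y)"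
          by (metis H.cinner_J_right H.J_J)
        also have "\<dots> = cinner ?L (A.J (A.J u)) (?T (H.J y))"
          by (simp only: adj A.cinner_J)
        finally show "cinner ?K (A (A.J u)) y = 0" using u by simp
      qed
      then have "A.J u = 0" using A(3) by blast
      then show ?thesis by (metis A.J_J A.bop_J bop_zero)
    qed
    have "|E| =o |B|"
      by (rule S.factor_index[OF T fac dense B E(1)])
    moreover have "|E'| =o |B'|"
    proof (rule spectral_pair.factor_index[OF S.spectral_pair_uminus T _ dense B'])
      show "cinner ?K (- G f) g = cinner ?L (- A.J (?T f)) (?T g)" for f g
        by (simp add: H.L.cinner_minus_left A.L.cinner_minus_left fac)
      have "{x. - A.J x = x} = A.Lneg" by (rule Collect_cong) (metis minus_minus)
      then show "is_onb ?L {x. - A.J x = x} E'" using E'(1) by simp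
    qed
    ultimately show "|E| =o |B| \<and> |E'| =o |B'|" ..
  next
    assume "|E| =o |B| \<and> |E'| =o |B'|"
    then obtain A where A: "bop ?L ?K A" "\<And>f. A (A.J (adj ?L ?K A f)) = G f" "\<And>u. A u = 0 \<Longrightarrow> u = 0"
      using S.factor_exists[OF B B' E(1) E'(1)] by blast
    \<comment> \<open>The factorization so far is one of \<open>G = J\<^sub>\<H> C\<close>; composing the factor with \<open>J\<^sub>\<H>\<close> removes the
      symmetry on the left and is absorbed by the adjoint on the right.\<close>
    define A' where "A' u = H.J (A u)" for u
    have A': "bop ?L ?K A'" unfolding A'_def by (rule bop_comp[OF A(1) H.bop_J])
    have "adj ?L ?K A' (H.J g) = adj ?L ?K A g" for g
    proof (rule A.L.eq_if_cinner_eq)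
      fix u
      have "cinner ?L u (adj ?L ?K A' (H.J g)) = cinner ?K (A' u) (H.J g)"
        by (rule cinner_adj[OF A.L.hilbert_axioms H.L.pos_def_space_axioms A', symmetric])
      also have "\<dots> = cinner ?K (A u) g"
        using selfadjD[OF H.selfadj_J, of "A u" "H.J g"] by (simp add: A'_def)
      also have "\<dots> = cinner ?L u (adj ?L ?K A g)"
        by (rule cinner_adj[OF A.L.hilbert_axioms H.L.pos_def_space_axioms A(1)])
      finally show "cinner ?L (adj ?L ?K A' (H.J g)) u = cinner ?L (adj ?L ?K A g) u"
        by (metis A.L.cinner_hermitian)
    qed
    then have "C = A' \<circ> krein_adjoint \<A> \<H> A'"
      by (simp add: fun_eq_iff krein_adjoint_eq[OF assms(4,1) A'] A'_def A(2)) (simp add: G_def)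
    moreover have "{x. A' x = 0} = {0}"
      using A(3) bop_zero[OF A'] bop_zero[OF H.bop_J] H.J_J unfolding A'_def
      by (metis (mono_tags, lifting) Collect_cong singleton_conv)
    moreover have "A' \<in> bounded_ops \<A> \<H>"
      using A' bounded_ops_iff assms by blast
    ultimately show "\<exists>A \<in> bounded_ops \<A> \<H>. C = A \<circ> krein_adjoint \<A> \<H> A \<and> {x. A x = 0} = {0}"
      by blast
  qed
  also have "\<dots> \<longleftrightarrow> ind_pos \<A> =o herm_index_pos \<H> C \<and> ind_neg \<A> =o herm_index_neg \<H> C"
    unfolding E(2) E'(2) using pos neg ordIso_transitive ordIso_symmetric by blast
  finally show ?thesis .
qed

end
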